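(* Let $T$ be a countable complete NIP theory with monster model $\mathcal{U}$. Suppose $\mu\in\mathfrak{M}_x(\mathcal{U})$ is a Keisler measure which is finitely satisfiable over $M$, where $M\prec\mathcal{U}$ and $|M|=\aleph_0$. Then there exists a sequence $(\overline{a}_i)_{i\in\omega}$ of elements of $(M^x)^{<\omega}$ such that $\lim_{i\to\infty}\operatorname{Av}(\overline{a}_i)=\mu$; explicitly, for any formula $\varphi(x)\in\mathcal{L}_x(\mathcal{U})$, $$\lim_{i\to\infty}\operatorname{Av}(\overline{a}_i)(\varphi(x))=\mu(\varphi(x)).$$
   Context: $T$ is a complete first-order theory in a countable language, $\mathcal{U}$ is a monster model of $T$ (sufficiently saturated and strongly homogeneous), $x$ is a finite tuple of variables. $\mathcal{L}_x(A)$ is the Boolean algebra of formulas with free variables in $x$ and parameters from $A$, modulo logical equivalence. $\mathfrak{M}_x(\mathcal{U})$ is the space of Keisler measures, i.e. finitely additive probability measures on $\mathcal{L}_x(\mathcal{U})$, with the topology of pointwise convergence on formulas. $(M^x)^{<\omega}$ is the set of finite (nonempty) sequences of points of $M^x$. For $\overline{a}=(a_1,\dots,a_n)\in(\mathcal{U}^x)^{<\omega}$, $\operatorname{Av}(\overline{a})\in\mathfrak{M}_x(\mathcal{U})$ is defined by $\operatorname{Av}(\overline{a})(\psi(x))=\frac{1}{n}|\{1\le i\le n:\mathcal{U}\models\psi(a_i)\}|$. $\mu$ is finitely satisfiable over $M$ if for every $\varphi(x)\in\mathcal{L}_x(\mathcal{U})$ with $\mu(\varphi(x))>0$ there is $a\in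 M^x$ with $\mathcal{U}\models\varphi(a)$. *)

theory Defs
  imports "HOL-Analysis.Analysis"
begin

unbundle cardinal_syntax

section \<open>First-order syntax with parameters\<close>

record ('f, 'r) language =
  funs :: "'f set"
  rels :: "'r set"
  fun_arity :: "'f \<Rightarrow> nat"
  rel_arity :: "'r \<Rightarrow> nat"

definition countable_language :: "('f, 'r) language \<Rightarrow> bool" where
  "countable_language L \<longleftrightarrow> countable (funs L) \<and> countable (rels L)"

text \<open>Variables are natural numbers. \<open>Par c\<close> is a constant naming the element \<open>c\<close>; the formulas
  of the language itself are those over the empty parameter set.\<close>

datatype ('f, 'u) trm =
    Var nat
  | Par 'u
  | App 'f "('f, 'u) trm list"

datatype ('f, 'r, 'u) fm =
    Bot
  | Eq "('f, 'u) trm" "('f, 'u) trm"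
  | Rel 'r "('f, 'u) trm list"
  | Neg "('f, 'r, 'u) fm"
  | Conj "('f, 'r, 'u) fm" "('f, 'r, 'u) fm"
  | Exi nat "('f, 'r, 'u) fm"

abbreviation Top :: "('f, 'r, 'u) fm" where
  "Top \<equiv> Neg Bot"

abbreviation Disj :: "('f, 'r, 'u) fm \<Rightarrow> ('f, 'r, 'u) fm \<Rightarrow> ('f, 'r, 'u) fm" where
  "Disj p q \<equiv> Neg (Conj (Neg p) (Neg q))"

fun wf_trm :: "('f, 'r) language \<Rightarrow> 'u set \<Rightarrow> ('f, 'u) trm \<Rightarrow> bool" where
  "wf_trm L A (Var i) \<longleftrightarrow> True"
| "wf_trm L A (Par c) \<longleftrightarrow> c \<in> A"
| "wf_trm L A (App f ts) \<longleftrightarrow>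
     f \<in> funs L \<and> length ts = fun_arity L f \<and> (\<forall>t\<in>set ts. wf_trm L A t)"

fun wf_fm :: "('f, 'r) language \<Rightarrow> 'u set \<Rightarrow> ('f, 'r, 'u) fm \<Rightarrow> bool" where
  "wf_fm L A Bot \<longleftrightarrow> True"
| "wf_fm L A (Eq s t) \<longleftrightarrow> wf_trm L A s \<and> wf_trm L A t"
| "wf_fm L A (Rel r ts) \<longleftrightarrow>
     r \<in> rels L \<and> length ts = rel_arity L r \<and> (\<forall>t\<in>set ts. wf_trm L A t)"
| "wf_fm L A (Neg p) \<longleftrightarrow> wf_fm L A p"
| "wf_fm L A (Conj p q) \<longleftrightarrow> wf_fm L A p \<and> wf_fm L A q"
| "wf_fm L A (Exi i p) \<longleftrightarrow> wf_fm L A p"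

fun fv_trm :: "('f, 'u) trm \<Rightarrow> nat set" where
  "fv_trm (Var i) = {i}"
| "fv_trm (Par c) = {}"
| "fv_trm (App f ts) = (\<Union>t\<in>set ts. fv_trm t)"

fun fv :: "('f, 'r, 'u) fm \<Rightarrow> nat set" where
  "fv Bot = {}"
| "fv (Eq s t) = fv_trm s \<union> fv_trm t"
| "fv (Rel r ts) = (\<Union>t\<in>set ts. fv_trm t)"
| "fv (Neg p) = fv p"
| "fv (Conj p q) = fv p \<union> fv q"
| "fv (Exi i p) = fv p - {i}"

text \<open>The formulas with parameters from \<open>A\<close> and free variables in \<open>x\<close>. A tuple of variables is
  given by the set \<open>x\<close> of its entries.\<close>

definition formulas :: "('f, 'r) language \<Rightarrow> nat set \<Rightarrow> 'u set \<Rightarrow> ('f, 'r, 'u) fm set" where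
  "formulas L x A = {p. wf_fm L A p \<and> fv p \<subseteq> x}"

abbreviation sentences :: "('f, 'r) language \<Rightarrow> ('f, 'r, 'u) fm set" where
  "sentences L \<equiv> formulas L {} {}"

section \<open>Structures and satisfaction\<close>

record ('f, 'r, 'u) struct =
  univ :: "'u set"
  fun_int :: "'f \<Rightarrow> 'u list \<Rightarrow> 'u"
  rel_int :: "'r \<Rightarrow> 'u list \<Rightarrow> bool"

definition is_struct :: "('f, 'r) language \<Rightarrow> ('f, 'r, 'u) struct \<Rightarrow> bool" where
  "is_struct L N \<longleftrightarrow> univ N \<noteq> {} \<and>
     (\<forall>f\<in>funs L. \<forall>as\<in>lists (univ N). length as = fun_arity L f \<longrightarrow> fun_int N f as \<in> univ N)"

text \<open>The \<open>x\<close>-tuples of elements of \<open>N\<close>, as extensional functions on \<open>x\<close>; such a tuple is itself an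
  assignment for the formulas with free variables in \<open>x\<close>.\<close>

abbreviation tuples :: "('f, 'r, 'u) struct \<Rightarrow> nat set \<Rightarrow> (nat \<Rightarrow> 'u) set" where
  "tuples N x \<equiv> x \<rightarrow>\<^sub>E univ N"

fun trm_val :: "('f, 'r, 'u) struct \<Rightarrow> (nat \<Rightarrow> 'u) \<Rightarrow> ('f, 'u) trm \<Rightarrow> 'u" where
  "trm_val N v (Var i) = v i"
| "trm_val N v (Par c) = c"
| "trm_val N v (App f ts) = fun_int N f (map (trm_val N v) ts)"

fun sat :: "('f, 'r, 'u) struct \<Rightarrow> ('f, 'r, 'u) fm \<Rightarrow> (nat \<Rightarrow> 'u) \<Rightarrow> bool" where
  "sat N Bot v \<longleftrightarrow> False"
| "sat N (Eq s t) v \<longleftrightarrow> trm_val N v s = trm_val N v t"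
| "sat N (Rel r ts) v \<longleftrightarrow> rel_int N r (map (trm_val N v) ts)"
| "sat N (Neg p) v \<longleftrightarrow> \<not> sat N p v"
| "sat N (Conj p q) v \<longleftrightarrow> sat N p v \<and> sat N q v"
| "sat N (Exi i p) v \<longleftrightarrow> (\<exists>c\<in>univ N. sat N p (v(i := c)))"

definition elementary_substructure ::
  "('f, 'r) language \<Rightarrow> ('f, 'r, 'u) struct \<Rightarrow> ('f, 'r, 'u) struct \<Rightarrow> bool" where
  "elementary_substructure L M N \<longleftrightarrow>
     is_struct L M \<and> is_struct L N \<and> univ M \<subseteq> univ N \<and>
     (\<forall>f\<in>funs L. \<forall>as\<in>lists (univ M). length as = fun_arity L f \<longrightarrow> fun_int M f as = fun_int N f as) \<and>
     (\<forall>r\<in>rels L. \<forall>as\<in>lists (univ M). length as = rel_arity L r \<longrightarrow> rel_int M r as = rel_int N r as) \<and>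
     (\<forall>p\<in>formulas L UNIV {}. \<forall>v. v ` fv p \<subseteq> univ M \<longrightarrow> sat M p v = sat N p v)"

section \<open>Complete theories\<close>

definition models :: "('f, 'r) language \<Rightarrow> ('f, 'r, 'u) struct \<Rightarrow> ('f, 'r, 'u) fm set \<Rightarrow> bool" where
  "models L N T \<longleftrightarrow> is_struct L N \<and> (\<forall>s\<in>T. \<forall>v. sat N s v)"

text \<open>The models range over all structures whose universe is a subset of the type \<open>'u\<close>. If \<open>L\<close> is
  countable and \<open>'u\<close> is infinite, then by the downward Loewenheim-Skolem theorem this is entailment
  with respect to arbitrary structures.\<close>

definition entails :: "('f, 'r) language \<Rightarrow> ('f, 'r, 'u) fm set \<Rightarrow> ('f, 'r, 'u) fm \<Rightarrow> bool" where
  "entails L T s \<longleftrightarrow> (\<forall>N :: ('f, 'r, 'u) struct. models L N T \<longrightarrow> models L N {s})"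

definition complete_theory :: "('f, 'r) language \<Rightarrow> ('f, 'r, 'u) fm set \<Rightarrow> bool" where
  "complete_theory L T \<longleftrightarrow>
     T \<subseteq> sentences L \<and> \<not> entails L T Bot \<and>
     (\<forall>s\<in>sentences L. entails L T s \<or> entails L T (Neg s))"

section \<open>Monster models\<close>

text \<open>Cardinals are represented as in the library, by well-order relations \<open>\<kappa>\<close> with
  \<open>Card_order \<kappa>\<close>. Types are given by (possibly incomplete) finitely satisfiable sets of formulas.\<close>

definition saturated ::
  "('f, 'r) language \<Rightarrow> 'k rel \<Rightarrow> ('f, 'r, 'u) struct \<Rightarrow> bool" where
  "saturated L \<kappa> U \<longleftrightarrow>
     (\<forall>A x \<Sigma>. A \<subseteq> univ U \<and> |A| <o \<kappa> \<and> finite x \<and> \<Sigma> \<subseteq> formulas L x A \<and>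
        (\<forall>\<Sigma>\<^sub>0 \<subseteq> \<Sigma>. finite \<Sigma>\<^sub>0 \<longrightarrow> (\<exists>a\<in>tuples U x. \<forall>p\<in>\<Sigma>\<^sub>0. sat U p a))
        \<longrightarrow> (\<exists>a\<in>tuples U x. \<forall>p\<in>\<Sigma>. sat U p a))"

definition partial_elementary ::
  "('f, 'r) language \<Rightarrow> ('f, 'r, 'u) struct \<Rightarrow> 'u set \<Rightarrow> ('u \<Rightarrow> 'u) \<Rightarrow> bool" where
  "partial_elementary L U A h \<longleftrightarrow>
     A \<subseteq> univ U \<and> h ` A \<subseteq> univ U \<and>
     (\<forall>p\<in>formulas L UNIV {}. \<forall>v. v ` fv p \<subseteq> A \<longrightarrow> sat U p v = sat U p (h \<circ> v))"

definition automorphism ::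
  "('f, 'r) language \<Rightarrow> ('f, 'r, 'u) struct \<Rightarrow> ('u \<Rightarrow> 'u) \<Rightarrow> bool" where
  "automorphism L U \<sigma> \<longleftrightarrow>
     bij_betw \<sigma> (univ U) (univ U) \<and>
     (\<forall>f\<in>funs L. \<forall>as\<in>lists (univ U). length as = fun_arity L f \<longrightarrow>
        \<sigma> (fun_int U f as) = fun_int U f (map \<sigma> as)) \<and>
     (\<forall>r\<in>rels L. \<forall>as\<in>lists (univ U). length as = rel_arity L r \<longrightarrow>
        rel_int U r as = rel_int U r (map \<sigma> as))"

definition strongly_homogeneous ::
  "('f, 'r) language \<Rightarrow> 'k rel \<Rightarrow> ('f, 'r, 'u) struct \<Rightarrow> bool" where
  "strongly_homogeneous L \<kappa> U \<longleftrightarrow>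
     (\<forall>A h. |A| <o \<kappa> \<and> partial_elementary L U A h \<longrightarrow>
        (\<exists>\<sigma>. automorphism L U \<sigma> \<and> (\<forall>a\<in>A. \<sigma> a = h a)))"

text \<open>For a countable language, ``sufficiently'' saturated and homogeneous is read as: for some
  uncountable cardinal \<open>\<kappa>\<close>. In particular countable sets of parameters are small.\<close>

definition monster_model ::
  "('f, 'r) language \<Rightarrow> ('f, 'r, 'u) fm set \<Rightarrow> 'k rel \<Rightarrow> ('f, 'r, 'u) struct \<Rightarrow> bool" where
  "monster_model L T \<kappa> U \<longleftrightarrow>
     models L U T \<and> Card_order \<kappa> \<and> natLeq <o \<kappa> \<and>
     saturated L \<kappa> U \<and> strongly_homogeneous L \<kappa> U"

section \<open>NIP\<close>

text \<open>\<open>override_on b a x\<close> is the assignment given by the tuple \<open>a\<close> on \<open>x\<close> and by \<open>b\<close> elsewhere.\<close>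

definition shattered ::
  "('f, 'r, 'u) struct \<Rightarrow> nat set \<Rightarrow> nat set \<Rightarrow> ('f, 'r, 'u) fm \<Rightarrow> (nat \<Rightarrow> 'u) set \<Rightarrow> bool" where
  "shattered U x y p A \<longleftrightarrow>
     (\<forall>I \<subseteq> A. \<exists>b\<in>tuples U y. \<forall>a\<in>A. sat U p (override_on b a x) \<longleftrightarrow> a \<in> I)"

definition NIP_formula ::
  "('f, 'r, 'u) struct \<Rightarrow> nat set \<Rightarrow> nat set \<Rightarrow> ('f, 'r, 'u) fm \<Rightarrow> bool" where
  "NIP_formula U x y p \<longleftrightarrow> \<not> (\<exists>A \<subseteq> tuples U x. infinite A \<and> shattered U x y p A)"

text \<open>NIP of a complete theory, evaluated in its monster model \<open>U\<close>.\<close>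

definition NIP :: "('f, 'r) language \<Rightarrow> ('f, 'r, 'u) struct \<Rightarrow> bool" where
  "NIP L U \<longleftrightarrow>
     (\<forall>x y. finite x \<and> finite y \<and> x \<inter> y = {} \<longrightarrow> (\<forall>p\<in>formulas L (x \<union> y) {}. NIP_formula U x y p))"

section \<open>Keisler measures\<close>

definition equivalent ::
  "('f, 'r, 'u) struct \<Rightarrow> nat set \<Rightarrow> ('f, 'r, 'u) fm \<Rightarrow> ('f, 'r, 'u) fm \<Rightarrow> bool" where
  "equivalent U x p q \<longleftrightarrow> (\<forall>a\<in>tuples U x. sat U p a \<longleftrightarrow> sat U q a)"

text \<open>A function on the Boolean algebra of formulas modulo equivalence is represented by a function
  on formulas that respects equivalence; its values outside \<open>formulas L x (univ U)\<close> are
  irrelevant.\<close>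

definition keisler_measure ::
  "('f, 'r) language \<Rightarrow> ('f, 'r, 'u) struct \<Rightarrow> nat set \<Rightarrow> (('f, 'r, 'u) fm \<Rightarrow> real) \<Rightarrow> bool" where
  "keisler_measure L U x \<mu> \<longleftrightarrow>
     (\<forall>p\<in>formulas L x (univ U). \<forall>q\<in>formulas L x (univ U). equivalent U x p q \<longrightarrow> \<mu> p = \<mu> q) \<and>
     (\<forall>p\<in>formulas L x (univ U). 0 \<le> \<mu> p) \<and>
     \<mu> Top = 1 \<and>
     (\<forall>p\<in>formulas L x (univ U). \<forall>q\<in>formulas L x (univ U).
        equivalent U x (Conj p q) Bot \<longrightarrow> \<mu> (Disj p q) = \<mu> p + \<mu> q)"

definition finitely_satisfiable ::
  "('f, 'r) language \<Rightarrow> ('f, 'r, 'u) struct \<Rightarrow> nat set \<Rightarrow> ('f, 'r, 'u) struct \<Rightarrow>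
     (('f, 'r, 'u) fm \<Rightarrow> real) \<Rightarrow> bool" where
  "finitely_satisfiable L U x M \<mu> \<longleftrightarrow>
     (\<forall>p\<in>formulas L x (univ U). \<mu> p > 0 \<longrightarrow> (\<exists>a\<in>tuples M x. sat U p a))"

definition Av :: "('f, 'r, 'u) struct \<Rightarrow> (nat \<Rightarrow> 'u) list \<Rightarrow> ('f, 'r, 'u) fm \<Rightarrow> real" where
  "Av U as p = real (card {i. i < length as \<and> sat U p (as ! i)}) / real (length as)"

lemma keisler_measure_Av:
  fixes U :: "('f, 'r, 'u) struct"
  assumes "as \<noteq> []" and "set as \<subseteq> tuples U x"
  shows "keisler_measure L U x (Av U as)"
proof -
  have mem: "as ! i \<in> tuples U x" if "i < length as" for i
    using assms(2) that by (meson nth_mem subsetD)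
  have "Av U as p = Av U as q" if "equivalent U x p q" for p q :: "('f, 'r, 'u) fm"
  proof -
    have "{i. i < length as \<and> sat U p (as ! i)} = {i. i < length as \<and> sat U q (as ! i)}"
      using that mem unfolding equivalent_def by blast
    then show ?thesis by (simp add: Av_def)
  qed
  moreover have "Av U as (Disj p q) = Av U as p + Av U as q"
    if "equivalent U x (Conj p q) Bot" for p q :: "('f, 'r, 'u) fm"
  proof -
    let ?S = "\<lambda>p. {i. i < length as \<and> sat U p (as ! i)}"
    have "?S (Disj p q) = ?S p \<union> ?S q" by auto
    moreover have "?S p \<inter> ?S q = {}"
      using that mem unfolding equivalent_def by auto
    ultimately have "card (?S (Disj p q)) = card (?S p) + card (?S q)"
      by (simp add: card_Un_disjoint)
    then show ?thesis unfolding Av_def by (simp add: add_divide_distrib)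
  qed
  ultimately show ?thesis
    using assms(1) unfolding keisler_measure_def by (auto simp: Av_def)
qed

end

theory Submission
  imports Defs
begin

text \<open>
  The points of \<open>M\<^sup>x\<close> are countably many, and a formula with parameters matters only through its
  trace on them. Finite satisfiability makes \<open>\<mu>\<close> a limit of averages of points of \<open>M\<^sup>x\<close>
  along some filter: for finitely many formulas the atoms of positive measure have points in \<open>M\<^sup>x\<close>,
  and these points can be repeated in the right proportions (\<open>keisler_approximation\<close>). What has to
  be shown is that a sequence does the work of the filter. This is a combinatorial statement about
  a countable set \<open>X\<close> and countably many families \<open>C\<close> of subsets of \<open>X\<close> (the traces of the instances
  of one formula), each of finite VC dimension; it is \<open>sequential_limit_of_averages\<close>.

  By compactness \<open>\<mu>\<close> extends to a mean \<open>\<nu>\<close>, a positive normalised linear functional on all bounded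
  functions on \<open>X\<close> which is still a cluster point of averages (\<open>cluster_mean\<close>). A sequence of averages
  can converge to \<open>\<nu>\<close> on a prescribed countable set \<open>G\<close> of bounded functions, so the point is to find
  a countable \<open>G\<close> such that agreement on \<open>G\<close> forces agreement on all the sets \<open>S \<in> C\<close>. This
  replaces the Morley sequence argument, by which an invariant type in an NIP theory is determined by
  the type over \<open>M\<close> of its Morley sequence.

  For a set \<open>J\<close> of positions consider on \<open>X\<^sup>n\<close> the function
  \<open>x \<mapsto> sup\<^sub>S\<^sub>\<in>\<^sub>C (\<Sum>j<n. \<plusminus> 1\<^sub>S(x\<^sub>j))\<close> with sign \<open>+\<close> exactly on \<open>J\<close>. Fix the first coordinates to points
  of \<open>X\<close>, leave the next one free and integrate the others with respect to \<open>\<nu>\<close>; all the functions of one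
  variable that arise form \<open>G\<close>, and there are only countably many because \<open>X\<close> is countable. If a mean \<open>\<kappa>\<close>
  agrees with \<open>\<nu>\<close> on \<open>G\<close>, then integrating over \<open>X\<^sup>n\<close> with \<open>\<nu>\<close> or \<open>\<kappa>\<close> chosen separately in every
  coordinate gives the same value as integrating with \<open>\<nu>\<close> throughout (\<open>iter_mean_eq_replicate\<close>).
  Suppose \<open>\<kappa>\<close> and \<open>\<nu>\<close> differ by \<open>\<delta> > 0\<close> on some \<open>S \<in> C\<close>. Choosing the mean that is larger on \<open>S\<close>
  in the positions of \<open>J\<close> and the smaller one elsewhere, and averaging over \<open>J\<close>, shows that the sum of
  the suprema over all \<open>J\<close> has integral at least \<open>2\<^sup>n n \<delta> / 2\<close>. Hence some \<open>x \<in> X\<^sup>n\<close> has Rademacher average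
  of order \<open>n \<delta>\<close> (\<open>exists_large_sup_signed_sum\<close>). But a family of finite VC dimension has only polynomially
  many traces on \<open>n\<close> points (Sauer-Shelah), so by Massart's bound its Rademacher averages are of
  order \<open>sqrt (n ln n)\<close>: a contradiction for large \<open>n\<close> (\<open>mean_indicator_le\<close>).

  It remains to get finite VC dimension out of NIP, which only excludes infinite shattered sets:
  saturation turns arbitrarily large finite shattered sets into an infinite one
  (\<open>infinite_shattered\<close>). The countably many families of traces are indexed by the formulas without
  parameters, of which every formula with parameters is an instance (\<open>formula_as_instance\<close>).
\<close>

section \<open>Averages and means\<close>

text \<open>Tychonoff's theorem for a product of compact intervals; the conclusion spells out that \<open>\<nu>\<close> is a
  cluster point in the product topology.\<close>

lemma cluster_functional:
  fixes V :: "'b \<Rightarrow> 'h \<Rightarrow> real"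
  assumes "F \<noteq> bot" and bound: "\<And>i h. \<bar>V i h\<bar> \<le> B h"
  obtains \<nu> where "\<And>H \<epsilon>. finite H \<Longrightarrow> 0 < \<epsilon> \<Longrightarrow> frequently (\<lambda>i. \<forall>h\<in>H. \<bar>V i h - \<nu> h\<bar> < \<epsilon>) F"
proof -
  define K where "K = (\<Pi>\<^sub>E h\<in>(UNIV :: 'h set). {- B h..B h})"
  have "compactin (product_topology (\<lambda>h. euclidean) UNIV) K"
    unfolding K_def by (subst compactin_PiE) auto
  then have "compact K"
    by (simp add: euclidean_product_topology)
  moreover have "filtermap V F \<le> principal K"
    unfolding le_principal eventually_filtermap
    using bound by (intro always_eventually) (auto simp: K_def abs_le_iff minus_le_iff)
  moreover have "filtermap V F \<noteq> bot"
    using assms(1) by (simp add: filtermap_bot_iff)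
  ultimately obtain \<nu> where \<nu>: "inf (nhds \<nu>) (filtermap V F) \<noteq> bot"
    unfolding compact_filter le_principal by blast
  have "frequently (\<lambda>i. \<forall>h\<in>H. \<bar>V i h - \<nu> h\<bar> < \<epsilon>) F" if "finite H" "0 < \<epsilon>" for H and \<epsilon> :: real
  proof (rule ccontr)
    let ?near = "\<lambda>w. \<forall>h\<in>H. \<bar>w h - \<nu> h\<bar> < \<epsilon>"
    assume "\<not> ?thesis"
    then have "eventually (\<lambda>w. \<not> ?near w) (filtermap V F)"
      by (simp add: frequently_def eventually_filtermap)
    moreover have "eventually ?near (nhds \<nu>)"
    proof -
      have "continuous_on UNIV (\<lambda>w :: 'h \<Rightarrow> real. \<bar>w h - \<nu> h\<bar>)" for h
        by (intro continuous_intros continuous_on_product_coordinates)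
      then have "open {w. \<bar>w h - \<nu> h\<bar> < \<epsilon>}" for h
        by (intro open_Collect_less continuous_on_const)
      then have "open (\<Inter>h\<in>H. {w. \<bar>w h - \<nu> h\<bar> < \<epsilon>})"
        using that(1) by blast
      moreover have "\<nu> \<in> (\<Inter>h\<in>H. {w. \<bar>w h - \<nu> h\<bar> < \<epsilon>})"
        using that(2) by simp
      ultimately show ?thesis
        unfolding eventually_nhds by (intro exI[of _ "\<Inter>h\<in>H. {w. \<bar>w h - \<nu> h\<bar> < \<epsilon>}"]) auto
    qed
    ultimately have "eventually (\<lambda>_. False) (inf (nhds \<nu>) (filtermap V F))"
      unfolding eventually_inf by blast
    then show False using \<nu> by (simp add: trivial_limit_def)
  qed
  then show thesis by (rule that)
qed

definition avg :: "'x list \<Rightarrow> ('x \<Rightarrow> real) \<Rightarrow> real" where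
  "avg as h = (\<Sum>a\<leftarrow>as. h a) / real (length as)"

text \<open>Means are integrals with respect to finitely additive probability measures on all subsets of the
  type; the values on unbounded functions are irrelevant.\<close>

definition mean :: "(('x \<Rightarrow> real) \<Rightarrow> real) \<Rightarrow> bool" where
  "mean \<nu> \<longleftrightarrow>
     (\<forall>f g. bounded (range f) \<longrightarrow> bounded (range g) \<longrightarrow> \<nu> (\<lambda>x. f x + g x) = \<nu> f + \<nu> g) \<and>
     (\<forall>c f. bounded (range f) \<longrightarrow> \<nu> (\<lambda>x. c * f x) = c * \<nu> f) \<and>
     (\<forall>f. bounded (range f) \<longrightarrow> (\<forall>x. 0 \<le> f x) \<longrightarrow> 0 \<le> \<nu> f) \<and>
     \<nu> (\<lambda>_. 1) = 1"

lemma bounded_range_iff: "bounded (range f) \<longleftrightarrow> (\<exists>B. \<forall>x. \<bar>f x :: real\<bar> \<le> B)"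
  by (auto simp: bounded_iff)

lemma bounded_range_add:
  fixes f g :: "'a \<Rightarrow> real"
  shows "bounded (range f) \<Longrightarrow> bounded (range g) \<Longrightarrow> bounded (range (\<lambda>x. f x + g x))"
  by (rule bounded_plus_comp)

lemma bounded_range_cmult:
  fixes f :: "'a \<Rightarrow> real"
  shows "bounded (range f) \<Longrightarrow> bounded (range (\<lambda>x. c * f x))"
  using bounded_scaling[of "range f" c] by (simp add: image_image)

lemma bounded_range_sum:
  fixes f :: "'i \<Rightarrow> 'a \<Rightarrow> real"
  shows "(\<And>i. i \<in> I \<Longrightarrow> bounded (range (f i))) \<Longrightarrow> bounded (range (\<lambda>x. \<Sum>i\<in>I. f i x))"
proof (induction I rule: infinite_finite_induct)
  case (insert i I)
  then show ?case by (simp add: bounded_range_add)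
qed auto

lemma bounded_range_indicator: "bounded (range (indicator S :: 'a \<Rightarrow> real))"
  by (auto simp: bounded_range_iff indicator_def intro!: exI[of _ 1])

lemma mean_add:
  "mean \<nu> \<Longrightarrow> bounded (range f) \<Longrightarrow> bounded (range g) \<Longrightarrow> \<nu> (\<lambda>x. f x + g x) = \<nu> f + \<nu> g"
  by (rule conjunct1[OF mean_def[of \<nu>, THEN iffD1], THEN spec, THEN spec, THEN mp, THEN mp])

lemma mean_cmult: "mean \<nu> \<Longrightarrow> bounded (range f) \<Longrightarrow> \<nu> (\<lambda>x. c * f x) = c * \<nu> f"
  by (rule conjunct1[OF conjunct2[OF mean_def[of \<nu>, THEN iffD1]], THEN spec, THEN spec, THEN mp])

lemma mean_nonneg: "mean \<nu> \<Longrightarrow> bounded (range f) \<Longrightarrow> (\<And>x. 0 \<le> f x) \<Longrightarrow> 0 \<le> \<nu> f"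
  by (rule conjunct1[OF conjunct2[OF conjunct2[OF mean_def[of \<nu>, THEN iffD1]]], THEN spec[of _ f], THEN mp, THEN mp]) auto

lemma mean_one: "mean \<nu> \<Longrightarrow> \<nu> (\<lambda>_. 1) = 1"
  by (rule conjunct2[OF conjunct2[OF conjunct2[OF mean_def[of \<nu>, THEN iffD1]]]])

lemma mean_const: "mean \<nu> \<Longrightarrow> \<nu> (\<lambda>_. c) = c"
  using mean_cmult[of \<nu> "\<lambda>_. 1" c] mean_one[of \<nu>] by simp

lemma mean_mono:
  assumes "mean \<nu>" "bounded (range f)" "bounded (range g)" "\<And>x. f x \<le> g x"
  shows "\<nu> f \<le> \<nu> g"
proof -
  have b: "bounded (range (\<lambda>x. - 1 * f x))"
    using assms(2) by (rule bounded_range_cmult)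
  have "0 \<le> \<nu> (\<lambda>x. g x + - 1 * f x)"
    by (rule mean_nonneg[OF assms(1) bounded_range_add[OF assms(3) b]]) (simp add: assms(4))
  also have "\<dots> = \<nu> g - \<nu> f"
    using mean_add[OF assms(1,3) b] mean_cmult[OF assms(1,2), of "- 1"] by simp
  finally show ?thesis by simp
qed

lemma mean_abs_le:
  assumes "mean \<nu>" "\<And>x. \<bar>f x\<bar> \<le> B"
  shows "\<bar>\<nu> f\<bar> \<le> B"
proof -
  have f: "bounded (range f)" using assms(2) by (auto simp: bounded_range_iff)
  have "\<nu> f \<le> B" "- B \<le> \<nu> f"
    using mean_mono[OF assms(1) f, of "\<lambda>_. B"] mean_mono[OF assms(1) _ f, of "\<lambda>_. - B"] assms(2)
    by (auto simp: mean_const[OF assms(1)] abs_le_iff minus_le_iff)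
  then show ?thesis by simp
qed

lemma avg_add: "avg as (\<lambda>x. f x + g x) = avg as f + avg as g"
  by (simp add: avg_def sum_list_addf add_divide_distrib)

lemma avg_cmult: "avg as (\<lambda>x. c * f x) = c * avg as f"
  by (simp add: avg_def sum_list_const_mult)

lemma avg_nonneg: "(\<And>x. 0 \<le> f x) \<Longrightarrow> 0 \<le> avg as f"
  by (auto simp: avg_def intro!: divide_nonneg_nonneg sum_list_nonneg)

lemma avg_one: "as \<noteq> [] \<Longrightarrow> avg as (\<lambda>_. 1) = 1"
  by (simp add: avg_def sum_list_triv)

lemma avg_abs_le: "(\<And>x. \<bar>f x\<bar> \<le> B) \<Longrightarrow> as \<noteq> [] \<Longrightarrow> \<bar>avg as f\<bar> \<le> B"
proof -
  assume B: "\<And>x. \<bar>f x\<bar> \<le> B" and "as \<noteq> []"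
  have "\<bar>\<Sum>a\<leftarrow>as. f a\<bar> \<le> real (length as) * B" for as
    using B by (induction as) (auto simp: algebra_simps intro: abs_triangle_ineq[THEN order_trans] add_mono)
  then show ?thesis using \<open>as \<noteq> []\<close> by (simp add: avg_def field_simps)
qed

text \<open>The defining identities of a mean involve finitely many functions at a time and hold for averages,
  so they survive in a cluster point.\<close>

lemma cluster_mean:
  fixes A :: "'b \<Rightarrow> 'x list"
  assumes "F \<noteq> bot" and nonempty: "\<And>i. A i \<noteq> []"
  obtains \<nu> where "mean \<nu>"
    and "\<And>H \<epsilon>. finite H \<Longrightarrow> (\<And>h. h \<in> H \<Longrightarrow> bounded (range h)) \<Longrightarrow> 0 < \<epsilon> \<Longrightarrow>
           frequently (\<lambda>i. \<forall>h\<in>H. \<bar>avg (A i) h - \<nu> h\<bar> < \<epsilon>) F"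
proof -
  \<comment> \<open>Compactness needs one bound for each function, so unbounded functions are sent to 0.\<close>
  define V where "V i h = (if bounded (range h) then avg (A i) h else 0)" for i h
  have "\<exists>B. \<forall>h. \<forall>i. \<bar>V i h\<bar> \<le> B h"
  proof (rule choice, intro allI)
    fix h :: "'x \<Rightarrow> real"
    show "\<exists>B. \<forall>i. \<bar>V i h\<bar> \<le> B"
    proof (cases "bounded (range h)")
      case True
      then obtain B where "\<And>x. \<bar>h x\<bar> \<le> B" by (auto simp: bounded_range_iff)
      with avg_abs_le[of h B] nonempty True show ?thesis by (auto simp: V_def)
    qed (auto simp: V_def)
  qed
  then obtain B where "\<And>i h. \<bar>V i h\<bar> \<le> B h" by blast
  from cluster_functional[of F V B, OF assms(1) this]
  obtain \<nu> where V: "\<And>H \<epsilon>. finite H \<Longrightarrow> 0 < \<epsilon> \<Longrightarrow> frequently (\<lambda>i. \<forall>h\<in>H. \<bar>V i h - \<nu> h\<bar> < \<epsilon>) F"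
    by blast
  have close: "frequently (\<lambda>i. \<forall>h\<in>H. \<bar>avg (A i) h - \<nu> h\<bar> < \<epsilon>) F"
    if "finite H" "\<And>h. h \<in> H \<Longrightarrow> bounded (range h)" "0 < \<epsilon>" for H \<epsilon>
    using V[OF that(1,3)] that(2) by (simp add: V_def)
  have near: "\<exists>i. \<forall>h\<in>H. \<bar>avg (A i) h - \<nu> h\<bar> < \<epsilon>"
    if "finite H" "\<And>h. h \<in> H \<Longrightarrow> bounded (range h)" "0 < \<epsilon>" for H \<epsilon>
    using close[OF that] by (rule frequently_ex)
  have small: "a = b" if "\<And>\<epsilon>. 0 < \<epsilon> \<Longrightarrow> \<bar>a - b\<bar> < c * \<epsilon>" "0 < c" for a b c :: real
  proof (rule ccontr)
    assume "a \<noteq> b"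
    then have "\<bar>a - b\<bar> < c * (\<bar>a - b\<bar> / c)" using that by (intro that(1)) auto
    then show False using that(2) by simp
  qed
  have "mean \<nu>"
    unfolding mean_def
  proof (intro conjI allI impI)
    fix f g :: "'x \<Rightarrow> real"
    assume f: "bounded (range f)" and g: "bounded (range g)"
    let ?s = "\<lambda>x. f x + g x"
    show "\<nu> ?s = \<nu> f + \<nu> g"
    proof (rule small)
      fix \<epsilon> :: real
      assume "0 < \<epsilon>"
      then obtain i where "\<forall>h\<in>{f, g, ?s}. \<bar>avg (A i) h - \<nu> h\<bar> < \<epsilon>"
        using near[of "{f, g, ?s}" \<epsilon>] f g bounded_range_add[OF f g] by auto
      then have "\<bar>avg (A i) f - \<nu> f\<bar> < \<epsilon>" "\<bar>avg (A i) g - \<nu> g\<bar> < \<epsilon>" "\<bar>avg (A i) ?s - \<nu> ?s\<bar> < \<epsilon>"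
        by blast+
      then show "\<bar>\<nu> ?s - (\<nu> f + \<nu> g)\<bar> < 3 * \<epsilon>"
        unfolding avg_add by linarith
    qed simp
  next
    fix c and f :: "'x \<Rightarrow> real"
    assume f: "bounded (range f)"
    let ?s = "\<lambda>x. c * f x"
    show "\<nu> ?s = c * \<nu> f"
    proof (rule small)
      fix \<epsilon> :: real
      assume "0 < \<epsilon>"
      then obtain i where i: "\<forall>h\<in>{f, ?s}. \<bar>avg (A i) h - \<nu> h\<bar> < \<epsilon>"
        using near[of "{f, ?s}" \<epsilon>] f bounded_range_cmult[OF f] by auto
      then have "\<bar>avg (A i) f - \<nu> f\<bar> < \<epsilon>" and 1: "\<bar>c * avg (A i) f - \<nu> ?s\<bar> < \<epsilon>"
        by (auto simp: avg_cmult)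
      then have "\<bar>c * avg (A i) f - c * \<nu> f\<bar> \<le> \<bar>c\<bar> * \<epsilon>"
        by (metis abs_ge_zero abs_mult less_imp_le mult_left_mono right_diff_distrib)
      with 1 show "\<bar>\<nu> ?s - c * \<nu> f\<bar> < (\<bar>c\<bar> + 1) * \<epsilon>"
        unfolding distrib_right by linarith
    qed simp
  next
    fix f :: "'x \<Rightarrow> real"
    assume f: "bounded (range f)" "\<forall>x. 0 \<le> f x"
    show "0 \<le> \<nu> f"
    proof (rule field_le_epsilon)
      fix \<epsilon> :: real
      assume "0 < \<epsilon>"
      then obtain i where "\<bar>avg (A i) f - \<nu> f\<bar> < \<epsilon>"
        using near[of "{f}" \<epsilon>] f by auto
      then show "0 \<le> \<nu> f + \<epsilon>"
        using avg_nonneg[of f "A i", OF f(2)[rule_format]] by linarith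
    qed
  next
    show "\<nu> (\<lambda>_. 1) = 1"
    proof (rule small)
      fix \<epsilon> :: real
      assume "0 < \<epsilon>"
      then obtain i where "\<bar>avg (A i) (\<lambda>_. 1) - \<nu> (\<lambda>_. 1)\<bar> < \<epsilon>"
        using near[of "{\<lambda>_. 1}" \<epsilon>] by auto
      then show "\<bar>\<nu> (\<lambda>_. 1) - 1\<bar> < 1 * \<epsilon>"
        using avg_one[OF nonempty, of i] by simp
    qed simp
  qed
  then show thesis using close by (rule that)
qed

section \<open>Iterated means\<close>

text \<open>The first mean of the list is the outermost integral and acts on the first coordinate. Finitely
  additive integrals do not commute, so this order matters.\<close>

fun iter_mean :: "(('x \<Rightarrow> real) \<Rightarrow> real) list \<Rightarrow> ('x list \<Rightarrow> real) \<Rightarrow> real" where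
  "iter_mean [] g = g []"
| "iter_mean (m # ms) g = m (\<lambda>x. iter_mean ms (\<lambda>xs. g (x # xs)))"

lemma bounded_range_Cons:
  fixes g :: "'x list \<Rightarrow> real"
  shows "bounded (range g) \<Longrightarrow> bounded (range (\<lambda>xs. g (x # xs)))"
  by (auto simp: bounded_range_iff)

lemma iter_mean_abs_le:
  assumes "\<And>m. m \<in> set ms \<Longrightarrow> mean m" "\<And>xs. \<bar>g xs\<bar> \<le> B"
  shows "\<bar>iter_mean ms g\<bar> \<le> B"
  using assms
proof (induction ms arbitrary: g)
  case (Cons m ms)
  then have "mean m" "\<And>x. \<bar>iter_mean ms (\<lambda>xs. g (x # xs))\<bar> \<le> B" by simp_all
  then show ?case unfolding iter_mean.simps by (rule mean_abs_le)
qed simp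

lemma bounded_range_iter_mean:
  assumes "\<And>m. m \<in> set ms \<Longrightarrow> mean m" "bounded (range g)"
  shows "bounded (range (\<lambda>x. iter_mean ms (\<lambda>xs. g (us @ x # xs))))"
proof -
  obtain B where "\<And>xs. \<bar>g xs\<bar> \<le> B" using assms(2) by (auto simp: bounded_range_iff)
  then have "\<bar>iter_mean ms (\<lambda>xs. g (us @ x # xs))\<bar> \<le> B" for x
    by (intro iter_mean_abs_le assms(1))
  then show ?thesis by (auto simp: bounded_range_iff)
qed

lemmas bounded_range_iter_mean_Cons = bounded_range_iter_mean[where us = "[]", simplified]

lemma iter_mean_add:
  assumes "\<And>m. m \<in> set ms \<Longrightarrow> mean m" "bounded (range f)" "bounded (range g)"
  shows "iter_mean ms (\<lambda>xs. f xs + g xs) = iter_mean ms f + iter_mean ms g"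
  using assms
proof (induction ms arbitrary: f g)
  case (Cons m ms)
  then have m: "mean m" and ms: "\<And>m. m \<in> set ms \<Longrightarrow> mean m" by simp_all
  show ?case
    using mean_add[OF m bounded_range_iter_mean_Cons[OF ms Cons.prems(2)] bounded_range_iter_mean_Cons[OF ms Cons.prems(3)]]
    by (simp add: Cons.IH ms bounded_range_Cons Cons.prems)
qed simp

lemma iter_mean_const:
  assumes "\<And>m. m \<in> set ms \<Longrightarrow> mean m"
  shows "iter_mean ms (\<lambda>xs. c) = c"
  using assms
proof (induction ms)
  case (Cons m ms)
  then show ?case using mean_const[of m c] by simp
qed simp

lemma iter_mean_mono:
  assumes "\<And>m. m \<in> set ms \<Longrightarrow> mean m" "bounded (range f)" "bounded (range g)" "\<And>xs. f xs \<le> g xs"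
  shows "iter_mean ms f \<le> iter_mean ms g"
  using assms
proof (induction ms arbitrary: f g)
  case (Cons m ms)
  then have m: "mean m" and ms: "\<And>m. m \<in> set ms \<Longrightarrow> mean m" by simp_all
  show ?case
    using mean_mono[OF m bounded_range_iter_mean_Cons[OF ms Cons.prems(2)] bounded_range_iter_mean_Cons[OF ms Cons.prems(3)]]
    by (simp add: Cons.IH ms bounded_range_Cons Cons.prems)
qed simp

lemma iter_mean_sum:
  assumes "\<And>m. m \<in> set ms \<Longrightarrow> mean m" "\<And>i. i \<in> I \<Longrightarrow> bounded (range (f i))"
  shows "iter_mean ms (\<lambda>xs. \<Sum>i\<in>I. f i xs) = (\<Sum>i\<in>I. iter_mean ms (f i))"
  using assms
proof (induction I rule: infinite_finite_induct)
  case (insert i I)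
  then show ?case by (simp add: iter_mean_add bounded_range_sum)
qed (simp_all add: iter_mean_const)

text \<open>Only the mean in position \<open>j\<close> sees a function of the coordinate \<open>j\<close>, the others being normalised.\<close>

lemma iter_mean_coordinates:
  fixes h :: "'x \<Rightarrow> real"
  assumes "\<And>m. m \<in> set ms \<Longrightarrow> mean m" "bounded (range h)"
  shows "iter_mean ms (\<lambda>xs. \<Sum>j<length ms. c j * h (xs ! j)) = (\<Sum>j<length ms. c j * (ms ! j) h)"
  using assms
proof (induction ms arbitrary: c)
  case (Cons m ms)
  then have m: "mean m" by simp
  have b: "bounded (range (\<lambda>xs. \<Sum>j<length ms. c (Suc j) * h (xs ! j)))"
    using Cons.prems(2) by (intro bounded_range_sum bounded_range_cmult) (auto simp: bounded_range_iff)
  have "iter_mean (m # ms) (\<lambda>xs. \<Sum>j<length (m # ms). c j * h (xs ! j))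
    = m (\<lambda>x. iter_mean ms (\<lambda>xs. c 0 * h x + (\<Sum>j<length ms. c (Suc j) * h (xs ! j))))"
    by (simp add: sum.lessThan_Suc_shift del: sum.lessThan_Suc)
  also have "\<dots> = m (\<lambda>x. c 0 * h x + (\<Sum>j<length ms. c (Suc j) * (ms ! j) h))"
    using Cons.prems b by (simp add: iter_mean_add iter_mean_const Cons.IH)
  also have "\<dots> = c 0 * m h + (\<Sum>j<length ms. c (Suc j) * (ms ! j) h)"
    using m mean_add[OF m bounded_range_cmult[OF Cons.prems(2), of "c 0"], of "\<lambda>_. \<Sum>j<length ms. c (Suc j) * (ms ! j) h"]
    by (simp add: mean_cmult[OF m Cons.prems(2)] mean_const[OF m])
  finally show ?case
    by (simp add: sum.lessThan_Suc_shift del: sum.lessThan_Suc)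
qed simp

text \<open>The means are replaced by \<open>\<nu>\<close> from the inside out. When the one in position \<open>length us\<close> is
  replaced, the outer coordinates are fixed to \<open>us\<close> and the inner means have already become \<open>\<nu>\<close>; this
  is why agreement on the tails of iterated \<open>\<nu>\<close>-means suffices.\<close>

lemma iter_mean_eq_replicate:
  fixes g :: "'x list \<Rightarrow> real"
  assumes "\<And>m. m \<in> set ms \<Longrightarrow> mean m" "mean \<nu>" "bounded (range g)"
    and "\<And>m us k. m \<in> set ms \<Longrightarrow> length us + Suc k = length ms \<Longrightarrow>
           m (\<lambda>x. iter_mean (replicate k \<nu>) (\<lambda>zs. g (us @ x # zs)))
             = \<nu> (\<lambda>x. iter_mean (replicate k \<nu>) (\<lambda>zs. g (us @ x # zs)))"
  shows "iter_mean ms g = iter_mean (replicate (length ms) \<nu>) g"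
  using assms
proof (induction ms arbitrary: g)
  case (Cons m ms)
  have "iter_mean ms (\<lambda>xs. g (x # xs)) = iter_mean (replicate (length ms) \<nu>) (\<lambda>xs. g (x # xs))" for x
  proof (rule Cons.IH)
    fix m' and us :: "'x list" and k
    assume "m' \<in> set ms" "length us + Suc k = length ms"
    then show "m' (\<lambda>y. iter_mean (replicate k \<nu>) (\<lambda>zs. g (x # us @ y # zs)))
             = \<nu> (\<lambda>y. iter_mean (replicate k \<nu>) (\<lambda>zs. g (x # us @ y # zs)))"
      using Cons.prems(4)[of m' "x # us" k] by simp
  qed (use Cons.prems in \<open>auto simp: bounded_range_Cons\<close>)
  then show ?case
    using Cons.prems(4)[of m "[]" "length ms"] by simp
qed simp

section \<open>Rademacher averages of families of finite VC dimension\<close>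

definition shatters :: "'x set set \<Rightarrow> 'x set \<Rightarrow> bool" where
  "shatters C J \<longleftrightarrow> (\<forall>I \<subseteq> J. \<exists>S\<in>C. S \<inter> J = I)"

text \<open>Pajor's form of the Sauer-Shelah lemma. For a point \<open>v\<close>, the family splits into the sets \<open>A\<close>
  without \<open>v\<close> and the sets \<open>B\<close> with \<open>v\<close> removed. What \<open>A \<union> B\<close> shatters is shattered by \<open>P\<close>, and what
  \<open>A \<inter> B\<close> shatters is still shattered after adding \<open>v\<close>.\<close>

lemma card_le_card_shattered:
  assumes "finite V" "P \<subseteq> Pow V"
  shows "card P \<le> card {J. J \<subseteq> V \<and> shatters P J}"
  using assms
proof (induction V arbitrary: P rule: finite_induct)
  case empty
  show ?case
  proof (cases "P = {}")
    case False
    then have "P = {{}}" using empty by auto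
    then have "{J. J \<subseteq> {} \<and> shatters P J} = {{}}" by (auto simp: shatters_def)
    then show ?thesis using \<open>P = {{}}\<close> by simp
  qed simp
next
  case (insert v V)
  define A where "A = {S \<in> P. v \<notin> S}"
  define B where "B = (\<lambda>S. S - {v}) ` {S \<in> P. v \<in> S}"
  let ?sh = "\<lambda>Q. {J. J \<subseteq> V \<and> shatters Q J}"
  have fin: "finite P" "finite A" "finite B"
    using insert.prems insert.hyps(1) finite_subset[of P "Pow (insert v V)"] by (auto simp: A_def B_def)
  have AB: "A \<subseteq> Pow V" "B \<subseteq> Pow V"
    using insert.prems by (auto simp: A_def B_def)
  have B_iff: "S \<in> B \<longleftrightarrow> insert v S \<in> P \<and> v \<notin> S" for S
    unfolding B_def by (auto simp: insert_absorb image_iff intro!: bexI[of _ "insert v S"])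
  have "inj_on (\<lambda>S. S - {v}) {S \<in> P. v \<in> S}"
    by (auto simp: inj_on_def)
  then have "card B = card {S \<in> P. v \<in> S}"
    unfolding B_def by (rule card_image)
  moreover have "card P = card A + card {S \<in> P. v \<in> S}"
    unfolding A_def using fin(1) by (subst card_Un_disjoint[symmetric]) (auto intro!: arg_cong[of _ _ card])
  ultimately have "card P = card (A \<union> B) + card (A \<inter> B)"
    using card_Un_Int[OF fin(2,3)] by simp
  also have "\<dots> \<le> card (?sh (A \<union> B)) + card (?sh (A \<inter> B))"
    using AB by (intro add_mono insert.IH) auto
  also have "\<dots> = card (?sh (A \<union> B)) + card (insert v ` ?sh (A \<inter> B))"
    using insert.hyps(2) by (subst card_image) (auto simp: inj_on_def insert_eq_iff subset_iff)
  also have "\<dots> = card (?sh (A \<union> B) \<union> insert v ` ?sh (A \<inter> B))"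
    using insert.hyps by (subst card_Un_disjoint) auto
  also have "\<dots> \<le> card {J. J \<subseteq> insert v V \<and> shatters P J}"
  proof (rule card_mono)
    have "shatters P J" if J: "J \<subseteq> V" and sh: "shatters (A \<union> B) J" for J
      unfolding shatters_def
    proof (intro allI impI)
      fix I assume "I \<subseteq> J"
      then obtain S where "S \<in> A \<union> B" "S \<inter> J = I"
        using sh unfolding shatters_def by blast
      moreover have "insert v S \<inter> J = S \<inter> J" using J insert.hyps by auto
      ultimately show "\<exists>S\<in>P. S \<inter> J = I" unfolding A_def using B_iff by (metis (no_types, lifting) Un_iff mem_Collect_eq)
    qed
    moreover have "shatters P (insert v J)" if J: "J \<subseteq> V" and sh: "shatters (A \<inter> B) J" for J
      unfolding shatters_def
    proof (intro allI impI)
      fix I assume "I \<subseteq> insert v J"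
      then have "I - {v} \<subseteq> J" by auto
      then obtain S where S: "S \<in> A" "S \<in> B" "S \<inter> J = I - {v}"
        using sh unfolding shatters_def by blast
      show "\<exists>S\<in>P. S \<inter> insert v J = I"
      proof (cases "v \<in> I")
        case True
        then have "insert v S \<inter> insert v J = I" using S \<open>I \<subseteq> insert v J\<close> by blast
        then show ?thesis using S(2) B_iff by blast
      next
        case False
        then have "S \<inter> insert v J = I" "S \<in> P" using S \<open>I \<subseteq> insert v J\<close> by (auto simp: A_def)
        then show ?thesis by blast
      qed
    qed
    ultimately show "?sh (A \<union> B) \<union> insert v ` ?sh (A \<inter> B) \<subseteq> {J. J \<subseteq> insert v V \<and> shatters P J}"
      by blast
    show "finite {J. J \<subseteq> insert v V \<and> shatters P J}"
      using insert.hyps(1) by simp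
  qed
  finally show ?case .
qed

lemma card_small_subsets:
  assumes "finite V"
  shows "card {J. J \<subseteq> V \<and> card J \<le> d} \<le> (card V + 1) ^ d"
proof -
  have "{J. J \<subseteq> V \<and> card J \<le> d} = (\<Union>i\<le>d. {J. J \<subseteq> V \<and> card J = i})"
    by auto
  then have "card {J. J \<subseteq> V \<and> card J \<le> d} \<le> (\<Sum>i\<le>d. card {J. J \<subseteq> V \<and> card J = i})"
    by (simp add: card_UN_le)
  also have "\<dots> \<le> (\<Sum>i\<le>d. card V ^ i)"
  proof (rule sum_mono)
    fix i
    show "card {J. J \<subseteq> V \<and> card J = i} \<le> card V ^ i"
      using n_subsets[OF assms, of i] binomial_le_pow[of i "card V"] 
      by (cases "i \<le> card V") (auto simp: binomial_eq_0)
  qed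
  also have "\<dots> \<le> (card V + 1) ^ d"
  proof (induction d)
    case (Suc d)
    have "card V ^ Suc d \<le> card V * (card V + 1) ^ d"
      by (simp add: power_mono)
    with Suc have "(\<Sum>i\<le>Suc d. card V ^ i) \<le> (card V + 1) ^ d + card V * (card V + 1) ^ d"
      unfolding sum.atMost_Suc by (rule add_mono)
    then show ?case by simp
  qed simp
  finally show ?thesis .
qed

lemma exp_add_exp_minus_le:
  fixes t :: real
  assumes "0 < t" "t \<le> 1"
  shows "exp t + exp (- t) \<le> 2 * exp (t\<^sup>2)"
proof -
  have "exp t \<le> 1 + t + t\<^sup>2"
    using assms by (intro exp_bound) auto
  moreover have "exp (- t) \<le> 1 - t + t\<^sup>2"
  proof -
    have pos: "0 < 1 - t + t\<^sup>2"
      using assms by (intro add_nonneg_pos) auto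
    have "1 \<le> (1 - t + t\<^sup>2) * (1 + t)"
      using assms by (simp add: power2_eq_square algebra_simps)
    also have "\<dots> \<le> (1 - t + t\<^sup>2) * exp t"
      using pos exp_ge_add_one_self[of t] by (intro mult_left_mono) auto
    finally show ?thesis
      by (simp add: exp_minus field_simps)
  qed
  moreover have "1 + t\<^sup>2 \<le> exp (t\<^sup>2)"
    by (rule exp_ge_add_one_self)
  ultimately show ?thesis by linarith
qed

lemma sum_Pow_exp:
  fixes a :: "'i \<Rightarrow> bool \<Rightarrow> real"
  assumes "finite V"
  shows "(\<Sum>J\<in>Pow V. exp (\<Sum>j\<in>V. a j (j \<in> J))) = (\<Prod>j\<in>V. exp (a j True) + exp (a j False))"
proof -
  have "exp (\<Sum>j\<in>V. a j (j \<in> J)) = (\<Prod>j\<in>J. exp (a j True)) * (\<Prod>j\<in>V - J. exp (a j False))"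
    if "J \<subseteq> V" for J
  proof -
    have "exp (\<Sum>j\<in>V. a j (j \<in> J)) = (\<Prod>j\<in>V. exp (a j (j \<in> J)))"
      using assms by (rule exp_sum)
    also have "\<dots> = (\<Prod>j\<in>J. exp (a j (j \<in> J))) * (\<Prod>j\<in>V - J. exp (a j (j \<in> J)))"
      by (subst prod.subset_diff[OF that assms]) (rule mult.commute)
    also have "\<dots> = (\<Prod>j\<in>J. exp (a j True)) * (\<Prod>j\<in>V - J. exp (a j False))"
      by (intro arg_cong2[of _ _ _ _ "(*)"] prod.cong) auto
    finally show ?thesis .
  qed
  then show ?thesis
    unfolding prod_add[OF assms] by (intro sum.cong) auto
qed

text \<open>Massart's bound on the Rademacher average of a finite class: a supremum over \<open>P\<close> is controlled by
  the sum over \<open>P\<close> of the exponentials, and these have independent factors. The tangent inequality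
  \<open>u \<le> K - 1 + exp (u - K)\<close>, with \<open>K\<close> the final bound, takes the place of Jensen's inequality.\<close>

lemma massart_finite_class:
  fixes z :: "nat set \<Rightarrow> real"
  assumes P: "P \<subseteq> Pow {..<n}" "P \<noteq> {}" and t: "0 < t" "t \<le> 1"
    and z: "\<And>J. J \<subseteq> {..<n} \<Longrightarrow> \<exists>I\<in>P. z J \<le> (\<Sum>j\<in>I. if j \<in> J then 1 else - 1)"
  shows "t * (\<Sum>J\<in>Pow {..<n}. z J) \<le> 2 ^ n * (ln (card P) + n * t\<^sup>2)"
proof -
  define K where "K = ln (card P) + n * t\<^sup>2"
  define Z where "Z I J = (\<Sum>j\<in>I. if j \<in> J then 1 else - 1 :: real)" for I J :: "nat set"
  have fin: "finite P" using P(1) by (rule finite_subset) simp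
  have pos: "0 < card P" using fin P(2) by (simp add: card_gt_0_iff)
  have expK: "exp K = card P * exp (n * t\<^sup>2)"
    using pos by (simp add: K_def exp_add)
  have Z: "(\<Sum>J\<in>Pow {..<n}. exp (t * Z I J)) \<le> 2 ^ n * exp (n * t\<^sup>2)" if "I \<in> P" for I
  proof -
    define a where "a j b = (if j \<in> I then (if b then t else - t) else 0)" for j b
    have I: "I \<subseteq> {..<n}" using that P by auto
    have "t * Z I J = (\<Sum>j<n. a j (j \<in> J))" for J
      unfolding Z_def sum_distrib_left
      using I by (intro sum.mono_neutral_cong_left) (auto simp: a_def)
    then have "(\<Sum>J\<in>Pow {..<n}. exp (t * Z I J)) = (\<Prod>j<n. exp (a j True) + exp (a j False))"
      using sum_Pow_exp[of "{..<n}" a] by simp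
    also have "\<dots> \<le> (\<Prod>j<n. 2 * exp (t\<^sup>2))"
      using exp_add_exp_minus_le[OF t] by (intro prod_mono) (auto simp: a_def)
    also have "\<dots> = 2 ^ n * exp (n * t\<^sup>2)"
      by (simp add: power_mult_distrib exp_of_nat_mult)
    finally show ?thesis .
  qed
  have "t * (\<Sum>J\<in>Pow {..<n}. z J) = (\<Sum>J\<in>Pow {..<n}. t * z J)"
    by (rule sum_distrib_left)
  also have "\<dots> \<le> (\<Sum>J\<in>Pow {..<n}. K - 1 + (\<Sum>I\<in>P. exp (t * Z I J)) / exp K)"
  proof (rule sum_mono)
    fix J assume "J \<in> Pow {..<n}"
    then obtain I where I: "I \<in> P" "z J \<le> Z I J" using z unfolding Z_def by blast
    have "t * z J \<le> t * Z I J" using I(2) t by simp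
    also have "\<dots> \<le> K - 1 + exp (t * Z I J - K)"
      using exp_ge_add_one_self[of "t * Z I J - K"] by linarith
    also have "exp (t * Z I J - K) = exp (t * Z I J) / exp K"
      by (rule exp_diff)
    also have "\<dots> \<le> (\<Sum>I\<in>P. exp (t * Z I J)) / exp K"
      using I(1) fin by (intro divide_right_mono member_le_sum) auto
    finally show "t * z J \<le> K - 1 + (\<Sum>I\<in>P. exp (t * Z I J)) / exp K" by simp
  qed
  also have "\<dots> = 2 ^ n * (K - 1) + (\<Sum>J\<in>Pow {..<n}. \<Sum>I\<in>P. exp (t * Z I J)) / exp K"
    by (simp add: sum.distrib card_Pow sum_divide_distrib)
  also have "(\<Sum>J\<in>Pow {..<n}. \<Sum>I\<in>P. exp (t * Z I J)) = (\<Sum>I\<in>P. \<Sum>J\<in>Pow {..<n}. exp (t * Z I J))"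
    by (rule sum.swap)
  also have "\<dots> / exp K \<le> (\<Sum>I\<in>P. 2 ^ n * exp (n * t\<^sup>2)) / exp K"
    using Z by (intro divide_right_mono sum_mono) auto
  also have "\<dots> = 2 ^ n"
    using pos unfolding expK by simp
  finally show ?thesis by (simp add: K_def algebra_simps)
qed

text \<open>The points may repeat, so traces are recorded as sets of indices; a shattered set of
  indices never contains a repetition.\<close>

lemma card_traces_le:
  fixes p :: "nat \<Rightarrow> 'x"
  assumes vc: "\<And>J. finite J \<Longrightarrow> shatters C J \<Longrightarrow> card J \<le> d"
  shows "card ((\<lambda>S. {j. j < n \<and> p j \<in> S}) ` C) \<le> (n + 1) ^ d"
proof -
  let ?P = "(\<lambda>S. {j. j < n \<and> p j \<in> S}) ` C"
  have "card ?P \<le> card {J. J \<subseteq> {..<n} \<and> shatters ?P J}"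
    by (rule card_le_card_shattered) auto
  also have "\<dots> \<le> card {J. J \<subseteq> {..<n} \<and> card J \<le> d}"
  proof (rule card_mono)
    have "card J \<le> d" if J: "J \<subseteq> {..<n}" and sh: "shatters ?P J" for J
    proof -
      have trace: "\<exists>S\<in>C. {j \<in> J. p j \<in> S} = I" if I: "I \<subseteq> J" for I
      proof -
        obtain S where S: "S \<in> C" "{j. j < n \<and> p j \<in> S} \<inter> J = I"
          using sh I unfolding shatters_def by blast
        moreover have "{j. j < n \<and> p j \<in> S} \<inter> J = {j \<in> J. p j \<in> S}" using J by auto
        ultimately show ?thesis by auto
      qed
      have "inj_on p J"
      proof (rule inj_onI, rule ccontr)
        fix i j assume ij: "i \<in> J" "j \<in> J" "p i = p j" "i \<noteq> j"
        obtain S where S: "{j \<in> J. p j \<in> S} = {i}" using trace[of "{i}"] ij by auto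
        then have "p i \<in> S" by auto
        then have "j \<in> {j \<in> J. p j \<in> S}" using ij by simp
        then show False using S ij(4) by simp
      qed
      moreover have "card (p ` J) \<le> d"
      proof (rule vc)
        show "finite (p ` J)" using J by (simp add: finite_subset)
        show "shatters C (p ` J)"
          unfolding shatters_def
        proof (intro allI impI)
          fix I assume I: "I \<subseteq> p ` J"
          obtain S where S: "S \<in> C" "{j \<in> J. p j \<in> S} = {j \<in> J. p j \<in> I}"
            using trace[of "{j \<in> J. p j \<in> I}"] by auto
          then have "S \<inter> p ` J = I" using I by auto
          then show "\<exists>S\<in>C. S \<inter> p ` J = I" using S(1) by blast
        qed
      qed
      ultimately show ?thesis by (simp add: card_image)
    qed
    then show "{J. J \<subseteq> {..<n} \<and> shatters ?P J} \<subseteq> {J. J \<subseteq> {..<n} \<and> card J \<le> d}"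
      by blast
  qed simp
  also have "\<dots> \<le> (n + 1) ^ d"
    using card_small_subsets[of "{..<n}" d] by simp
  finally show ?thesis .
qed

definition signed_sum :: "nat \<Rightarrow> nat set \<Rightarrow> 'x set \<Rightarrow> 'x list \<Rightarrow> real" where
  "signed_sum n J S xs = (\<Sum>j<n. (if j \<in> J then 1 else - 1) * indicator S (xs ! j))"

definition sup_signed_sum :: "'x set set \<Rightarrow> nat \<Rightarrow> nat set \<Rightarrow> 'x list \<Rightarrow> real" where
  "sup_signed_sum C n J xs = (SUP S\<in>C. signed_sum n J S xs)"

lemma signed_sum_eq:
  "signed_sum n J S xs = (\<Sum>j\<in>{j. j < n \<and> xs ! j \<in> S}. if j \<in> J then 1 else - 1)"
  unfolding signed_sum_def by (intro sum.mono_neutral_cong_right) auto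

lemma signed_sum_abs_le: "\<bar>signed_sum n J S xs\<bar> \<le> n"
proof -
  have "\<bar>signed_sum n J S xs\<bar> \<le> (\<Sum>j<n. \<bar>(if j \<in> J then 1 else - 1) * indicator S (xs ! j) :: real\<bar>)"
    unfolding signed_sum_def by (rule sum_abs)
  also have "\<dots> \<le> (\<Sum>j<n. 1)"
    by (intro sum_mono) (auto simp: indicator_def)
  finally show ?thesis by simp
qed

text \<open>A signed sum depends only on the trace of \<open>S\<close> on \<open>n\<close> points, so even for an infinite family
  the supremum is a maximum.\<close>

lemma finite_signed_sums: "finite ((\<lambda>S. signed_sum n J S xs) ` C)"
proof -
  have "(\<lambda>S. signed_sum n J S xs) ` C \<subseteq> (\<lambda>I. \<Sum>j\<in>I. if j \<in> J then 1 else - 1) ` Pow {..<n}"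
    unfolding signed_sum_eq by auto
  then show ?thesis by (rule finite_subset) simp
qed

lemma signed_sum_le_sup: "S \<in> C \<Longrightarrow> signed_sum n J S xs \<le> sup_signed_sum C n J xs"
  unfolding sup_signed_sum_def by (intro cSUP_upper bounded_imp_bdd_above finite_imp_bounded finite_signed_sums)

lemma sup_signed_sum_attained:
  assumes "C \<noteq> {}"
  obtains S where "S \<in> C" "sup_signed_sum C n J xs = signed_sum n J S xs"
proof -
  have "sup_signed_sum C n J xs \<in> (\<lambda>S. signed_sum n J S xs) ` C"
    unfolding sup_signed_sum_def using assms finite_signed_sums by (subst cSup_eq_Max) (auto intro!: Max_in)
  then show thesis using that by blast
qed

lemma bounded_range_sup_signed_sum: "bounded (range (sup_signed_sum C n J))"
proof (cases "C = {}")
  case False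
  have "\<bar>sup_signed_sum C n J xs\<bar> \<le> n" for xs
    using sup_signed_sum_attained[OF False, of n J xs] signed_sum_abs_le by metis
  then show ?thesis by (auto simp: bounded_range_iff)
qed (simp add: sup_signed_sum_def)

section \<open>Countably many functions determine a mean on a family of finite VC dimension\<close>

text \<open>The functions of one variable on which a mean has to agree with \<open>\<nu>\<close>. The sign set \<open>J\<close> will be finite and
  the points \<open>us\<close> range over a countable set, so there are countably many for each family \<open>C\<close>.\<close>

definition tail_mean :: "(('x \<Rightarrow> real) \<Rightarrow> real) \<Rightarrow> 'x set set \<Rightarrow> nat \<Rightarrow> nat set \<Rightarrow> 'x list \<Rightarrow> nat \<Rightarrow> 'x \<Rightarrow> real" where
  "tail_mean \<nu> C n J us k x = iter_mean (replicate k \<nu>) (\<lambda>zs. sup_signed_sum C n J (us @ x # zs))"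

lemma bounded_range_tail_mean: "mean \<nu> \<Longrightarrow> bounded (range (tail_mean \<nu> C n J us k))"
  unfolding tail_mean_def by (intro bounded_range_iter_mean bounded_range_sup_signed_sum) auto

text \<open>In the positions \<open>J\<close> the coordinate is integrated with \<open>\<beta>\<close>, elsewhere with \<open>\<alpha>\<close>. For the single
  set \<open>S\<close> this mixed integral of the signed sum is \<open>\<beta>(S) |J| - \<alpha>(S) (n - |J|)\<close>, whose mean over all \<open>J\<close>
  is \<open>n \<delta> / 2\<close>. The mixed integral of the supremum does not depend on the mixture, so all the suprema can be
  evaluated at the same point.\<close>

lemma exists_large_sup_signed_sum:
  assumes mean: "mean \<nu>" "mean \<alpha>" "mean \<beta>"
    and \<alpha>: "\<And>J us k. finite J \<Longrightarrow> \<alpha> (tail_mean \<nu> C n J us k) = \<nu> (tail_mean \<nu> C n J us k)"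
    and \<beta>: "\<And>J us k. finite J \<Longrightarrow> \<beta> (tail_mean \<nu> C n J us k) = \<nu> (tail_mean \<nu> C n J us k)"
    and S: "S \<in> C" and \<delta>: "\<delta> = \<beta> (indicator S) - \<alpha> (indicator S)"
    and pos: "0 < n" "0 < \<delta>"
  obtains xs where "2 ^ n * (n * \<delta> / 4) \<le> (\<Sum>J\<in>Pow {..<n}. sup_signed_sum C n J xs)"
proof -
  define ms where "ms J = map (\<lambda>j. if j \<in> J then \<beta> else \<alpha>) [0..<n]" for J
  have ms: "length (ms J) = n" "\<And>m. m \<in> set (ms J) \<Longrightarrow> mean m" for J
    using mean by (auto simp: ms_def split: if_splits)
  have reps: "\<And>m. m \<in> set (replicate n \<nu>) \<Longrightarrow> mean m" using mean by simp
  let ?V = "{..<n}"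
  let ?s = "\<lambda>J. \<Sum>j<n. if j \<in> J then \<beta> (indicator S) else - \<alpha> (indicator S)"
  have lower: "?s J \<le> iter_mean (replicate n \<nu>) (sup_signed_sum C n J)" if "J \<in> Pow ?V" for J
  proof -
    have J: "finite J" using that by (auto intro: finite_subset)
    have "?s J = (\<Sum>j<length (ms J). (if j \<in> J then 1 else - 1) * (ms J ! j) (indicator S))"
      unfolding ms(1) by (intro sum.cong) (auto simp: ms_def)
    also have "\<dots> = iter_mean (ms J) (signed_sum n J S)"
      using iter_mean_coordinates[of "ms J" "indicator S" "\<lambda>j. if j \<in> J then 1 else - 1", OF ms(2) bounded_range_indicator]
      by (simp only: ms(1) signed_sum_def[abs_def])
    also have "\<dots> \<le> iter_mean (ms J) (sup_signed_sum C n J)"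
    proof (rule iter_mean_mono[OF ms(2)])
      show "bounded (range (signed_sum n J S))"
        using signed_sum_abs_le[of n J S] by (auto simp: bounded_range_iff)
    qed (auto simp: bounded_range_sup_signed_sum signed_sum_le_sup S)
    also have "\<dots> = iter_mean (replicate (length (ms J)) \<nu>) (sup_signed_sum C n J)"
    proof (rule iter_mean_eq_replicate[OF ms(2) mean(1) bounded_range_sup_signed_sum])
      fix m us k
      assume "m \<in> set (ms J)"
      then have "m = \<alpha> \<or> m = \<beta>" by (auto simp: ms_def split: if_splits)
      then show "m (\<lambda>x. iter_mean (replicate k \<nu>) (\<lambda>zs. sup_signed_sum C n J (us @ x # zs)))
          = \<nu> (\<lambda>x. iter_mean (replicate k \<nu>) (\<lambda>zs. sup_signed_sum C n J (us @ x # zs)))"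
        using \<alpha>[OF J, of us k] \<beta>[OF J, of us k] unfolding tail_mean_def[abs_def] by auto
    qed
    finally show ?thesis by (simp add: ms(1))
  qed
  \<comment> \<open>Every position is counted with both signs, so pairing J with its complement averages them out.\<close>
  have "(\<Sum>J\<in>Pow ?V. ?s J) = (\<Sum>J\<in>Pow ?V. ?s (?V - J))"
    by (rule sum.reindex_bij_witness[of _ "\<lambda>J. ?V - J" "\<lambda>J. ?V - J"]) (auto simp: double_diff)
  then have "2 * (\<Sum>J\<in>Pow ?V. ?s J) = (\<Sum>J\<in>Pow ?V. ?s J + ?s (?V - J))"
    by (simp add: sum.distrib)
  also have "\<dots> = (\<Sum>J\<in>Pow ?V. \<Sum>j<n. \<delta>)"
    unfolding sum.distrib[symmetric] by (intro sum.cong) (auto simp: \<delta>)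
  also have "\<dots> = 2 ^ n * (n * \<delta>)"
    by (simp add: card_Pow)
  finally have total: "2 * (\<Sum>J\<in>Pow ?V. ?s J) = 2 ^ n * (n * \<delta>)" .
  have sum_sup: "(\<Sum>J\<in>Pow ?V. ?s J) \<le> iter_mean (replicate n \<nu>) (\<lambda>xs. \<Sum>J\<in>Pow ?V. sup_signed_sum C n J xs)"
    using lower by (subst iter_mean_sum[OF reps bounded_range_sup_signed_sum]) (auto intro: sum_mono)
  \<comment> \<open>The factor 1/4 instead of 1/2 leaves room for a supremum of the integrand that is not attained.\<close>
  have "\<exists>xs. 2 ^ n * (n * \<delta> / 4) \<le> (\<Sum>J\<in>Pow ?V. sup_signed_sum C n J xs)"
  proof (rule ccontr)
    assume "\<not> ?thesis"
    then have "(\<Sum>J\<in>Pow ?V. sup_signed_sum C n J xs) \<le> 2 ^ n * (n * \<delta> / 4)" for xs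
      by (meson linear)
    then have "iter_mean (replicate n \<nu>) (\<lambda>xs. \<Sum>J\<in>Pow ?V. sup_signed_sum C n J xs)
        \<le> iter_mean (replicate n \<nu>) (\<lambda>xs. 2 ^ n * (n * \<delta> / 4))"
      by (intro iter_mean_mono[OF reps] bounded_range_sum bounded_range_sup_signed_sum) auto
    also have "iter_mean (replicate n \<nu>) (\<lambda>xs. 2 ^ n * (n * \<delta> / 4)) = 2 ^ n * (n * \<delta> / 4)"
      by (rule iter_mean_const) (rule reps)
    finally have "(\<Sum>J\<in>Pow ?V. ?s J) \<le> 2 ^ n * (n * \<delta> / 4)"
      using sum_sup by linarith
    with total have "2 ^ n * (n * \<delta>) \<le> 2 ^ n * (n * \<delta>) / 2"
      by linarith
    moreover have "0 < 2 ^ n * (n * \<delta>)" using pos by simp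
    ultimately show False by linarith
  qed
  then show thesis using that by blast
qed

text \<open>Otherwise there would be Rademacher averages linear in \<open>n\<close>, against the bound of order
  \<open>sqrt (n ln n)\<close> from Massart and Sauer-Shelah.\<close>

lemma mean_indicator_le:
  assumes vc: "\<And>J. finite J \<Longrightarrow> shatters C J \<Longrightarrow> card J \<le> d"
    and mean: "mean \<nu>" "mean \<alpha>" "mean \<beta>"
    and \<alpha>: "\<And>n J us k. finite J \<Longrightarrow> \<alpha> (tail_mean \<nu> C n J us k) = \<nu> (tail_mean \<nu> C n J us k)"
    and \<beta>: "\<And>n J us k. finite J \<Longrightarrow> \<beta> (tail_mean \<nu> C n J us k) = \<nu> (tail_mean \<nu> C n J us k)"
    and S: "S \<in> C"
  shows "\<beta> (indicator S) \<le> \<alpha> (indicator S)"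
proof (rule ccontr)
  define \<delta> where "\<delta> = \<beta> (indicator S) - \<alpha> (indicator S)"
  \<comment> \<open>This t makes the left-hand side of the Massart bound equal to twice its quadratic term.\<close>
  define t where "t = \<delta> / 8"
  assume "\<not> ?thesis"
  then have \<delta>: "0 < \<delta>" by (simp add: \<delta>_def)
  have "\<bar>\<alpha> (indicator S)\<bar> \<le> 1" "\<bar>\<beta> (indicator S)\<bar> \<le> 1"
    using mean by (auto intro!: mean_abs_le[of \<alpha>] mean_abs_le[of \<beta>] simp: indicator_def)
  then have t: "0 < t" "t \<le> 1" using \<delta> by (auto simp: t_def \<delta>_def)
  have upper: "n * t\<^sup>2 \<le> d * ln (real n + 1)" if n: "0 < n" for n
  proof -
    obtain xs where xs: "2 ^ n * (n * \<delta> / 4) \<le> (\<Sum>J\<in>Pow {..<n}. sup_signed_sum C n J xs)"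
      using exists_large_sup_signed_sum[OF mean \<alpha> \<beta> S \<delta>_def n \<delta>] by blast
    define P where "P = (\<lambda>S. {j. j < n \<and> xs ! j \<in> S}) ` C"
    have P: "P \<subseteq> Pow {..<n}" "P \<noteq> {}" using S by (auto simp: P_def)
    then have "finite P" by (auto intro: finite_subset)
    then have "0 < card P" using P(2) by (simp add: card_gt_0_iff)
    have "t * (2 ^ n * (n * \<delta> / 4)) \<le> t * (\<Sum>J\<in>Pow {..<n}. sup_signed_sum C n J xs)"
      using xs t by (intro mult_left_mono) auto
    also have "\<dots> \<le> 2 ^ n * (ln (card P) + n * t\<^sup>2)"
    proof (rule massart_finite_class[OF P t])
      fix J
      obtain S' where "S' \<in> C" "sup_signed_sum C n J xs = signed_sum n J S' xs"
        using sup_signed_sum_attained[of C n J xs] S by blast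
      then show "\<exists>I\<in>P. sup_signed_sum C n J xs \<le> (\<Sum>j\<in>I. if j \<in> J then 1 else - 1)"
        unfolding P_def by (auto simp: signed_sum_eq)
    qed
    finally have "2 ^ n * (2 * (n * t\<^sup>2)) \<le> 2 ^ n * (ln (card P) + n * t\<^sup>2)"
      by (simp add: t_def power2_eq_square field_simps)
    then have "2 * (n * t\<^sup>2) \<le> ln (card P) + n * t\<^sup>2"
      by (rule mult_left_le_imp_le) simp
    also have "ln (card P) \<le> ln (real ((n + 1) ^ d))"
      using card_traces_le[of C d n "\<lambda>j. xs ! j", OF vc] \<open>0 < card P\<close>
      unfolding P_def[symmetric] by (subst ln_le_cancel_iff) (auto simp flip: of_nat_Suc of_nat_power)
    also have "\<dots> = d * ln (real n + 1)"
      by (simp add: ln_realpow add.commute)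
    finally show ?thesis by simp
  qed
  have "\<forall>\<^sub>F n in sequentially. d * ln (real n + 1) < n * t\<^sup>2"
  proof -
    define c where "c = t\<^sup>2 / (2 * (real d + 1))"
    have c: "0 < c" using t(1) by (simp add: c_def)
    have "(\<lambda>n. ln (real (n + 1)) / real (n + 1)) \<longlonglongrightarrow> 0"
      using lim_ln_over_n by (rule LIMSEQ_ignore_initial_segment)
    then have "\<forall>\<^sub>F n in sequentially. ln (real (n + 1)) / real (n + 1) < c"
      using c by (rule order_tendstoD)
    then show ?thesis
      using eventually_gt_at_top[of 0]
    proof eventually_elim
      case (elim n)
      then have "ln (real n + 1) < c * (real n + 1)" by (simp add: field_simps)
      then have "d * ln (real n + 1) \<le> d * (c * (real n + 1))" by (intro mult_left_mono) auto
      also have "\<dots> < (real d + 1) * (c * (real n + 1))" using c by simp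
      also have "\<dots> = t\<^sup>2 * (real n + 1) / 2" by (simp add: c_def field_simps)
      also have "\<dots> \<le> n * t\<^sup>2" using elim(2) t(1) by (simp add: field_simps)
      finally show ?case .
    qed
  qed
  then have "\<forall>\<^sub>F n :: nat in sequentially. False"
    using eventually_gt_at_top[of 0]
  proof eventually_elim
    case (elim n)
    then show False using upper[of n] by linarith
  qed
  then show False by simp
qed

lemma frequently_close_unique:
  fixes v :: "'b \<Rightarrow> real"
  assumes "\<And>\<epsilon>. 0 < \<epsilon> \<Longrightarrow> frequently (\<lambda>i. \<bar>v i - a\<bar> < \<epsilon>) F" and "(v \<longlongrightarrow> b) F"
  shows "a = b"
proof (rule ccontr)
  assume "a \<noteq> b"
  then have pos: "0 < \<bar>a - b\<bar> / 2" by simp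
  have "eventually (\<lambda>i. \<bar>v i - b\<bar> < \<bar>a - b\<bar> / 2) F"
    using tendstoD[OF assms(2) pos] by (simp add: dist_real_def)
  with assms(1)[OF pos] have "frequently (\<lambda>i. \<bar>v i - a\<bar> < \<bar>a - b\<bar> / 2 \<and> \<bar>v i - b\<bar> < \<bar>a - b\<bar> / 2) F"
    by (rule frequently_eventually_frequently)
  then obtain i where "\<bar>v i - a\<bar> < \<bar>a - b\<bar> / 2" "\<bar>v i - b\<bar> < \<bar>a - b\<bar> / 2"
    using frequently_ex by blast
  moreover have "\<bar>a - b\<bar> \<le> \<bar>v i - a\<bar> + \<bar>v i - b\<bar>" by linarith
  ultimately show False using pos by (simp add: field_simps)
qed

section \<open>Limits of averages along filters are limits of sequences\<close>

text \<open>The statement is of the kind proved by Bourgain, Fremlin and Talagrand: on classes of finite VC dimension,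
  points in the closure of the averages are limits of sequences of averages. If the chosen sequence
  failed to converge on \<open>S\<close>, a cluster point \<open>\<kappa>\<close> of a bad subsequence would agree with \<open>\<nu>\<close> on \<open>G\<close> but not
  on \<open>S\<close>.\<close>

lemma sequential_limit_of_averages:
  fixes A :: "'b \<Rightarrow> 'x :: countable list"
  assumes "F \<noteq> bot" and nonempty: "\<And>i. A i \<noteq> []"
    and "countable \<C>" and vc: "\<And>C. C \<in> \<C> \<Longrightarrow> \<exists>d. \<forall>J. finite J \<longrightarrow> shatters C J \<longrightarrow> card J \<le> d"
  obtains a :: "nat \<Rightarrow> 'x list" where "\<And>i. a i \<noteq> []"
    and "\<And>C S l. C \<in> \<C> \<Longrightarrow> S \<in> C \<Longrightarrow> ((\<lambda>i. avg (A i) (indicator S)) \<longlongrightarrow> l) F \<Longrightarrow>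
           (\<lambda>i. avg (a i) (indicator S)) \<longlonglongrightarrow> l"
proof -
  obtain \<nu> where \<nu>: "mean \<nu>" and near: "\<And>H \<epsilon>. finite H \<Longrightarrow> (\<And>h. h \<in> H \<Longrightarrow> bounded (range h)) \<Longrightarrow> 0 < \<epsilon> \<Longrightarrow>
      frequently (\<lambda>i. \<forall>h\<in>H. \<bar>avg (A i) h - \<nu> h\<bar> < \<epsilon>) F"
    using cluster_mean[where A = A, OF assms(1) nonempty] by blast
  define G where "G = insert (\<lambda>_. 0)
    ((\<lambda>(C, n, J, us, k). tail_mean \<nu> C n J us k) ` (\<C> \<times> UNIV \<times> {J. finite J} \<times> UNIV \<times> UNIV))"
  have G: "tail_mean \<nu> C n J us k \<in> G" if "C \<in> \<C>" "finite J" for C n J us k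
    unfolding G_def using that by (intro insertI2 image_eqI[of _ _ "(C, n, J, us, k)"]) auto
  have "countable G"
    unfolding G_def using assms(3)
    by (intro countable_insert countable_image countable_SIGMA countable_Collect_finite) auto
  have "G \<noteq> {}" by (simp add: G_def)
  have bG: "bounded (range h)" if "h \<in> G" for h
    using that bounded_range_tail_mean[OF \<nu>] by (auto simp: G_def)
  define H where "H = from_nat_into G"
  have H: "H i \<in> G" for i unfolding H_def using \<open>G \<noteq> {}\<close> by (rule from_nat_into)
  have "\<exists>k. \<forall>h\<in>H ` {..i}. \<bar>avg (A k) h - \<nu> h\<bar> < 1 / real (Suc i)" for i
    using near[of "H ` {..i}" "1 / real (Suc i)"] bG[OF H] frequently_ex by auto
  then obtain k where k: "\<And>i h. h \<in> H ` {..i} \<Longrightarrow> \<bar>avg (A (k i)) h - \<nu> h\<bar> < 1 / real (Suc i)"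
    by metis
  define a where "a i = A (k i)" for i
  have lim: "(\<lambda>i. avg (a i) h) \<longlonglongrightarrow> \<nu> h" if h: "h \<in> G" for h
  proof -
    obtain j where j: "h = H j"
      using from_nat_into_surj[OF \<open>countable G\<close> h] unfolding H_def by blast
    have "\<forall>\<^sub>F i in sequentially. norm (avg (a i) h - \<nu> h) \<le> 1 / real (Suc i)"
      using eventually_ge_at_top[of j] by eventually_elim (use k j a_def less_imp_le in fastforce)
    moreover have "(\<lambda>i. 1 / real (Suc i)) \<longlonglongrightarrow> 0"
      using LIMSEQ_inverse_real_of_nat by (simp add: inverse_eq_divide)
    ultimately have "(\<lambda>i. avg (a i) h - \<nu> h) \<longlonglongrightarrow> 0"
      by (rule Lim_null_comparison)
    then show ?thesis by (simp add: LIM_zero_iff)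
  qed
  have "(\<lambda>i. avg (a i) (indicator S)) \<longlonglongrightarrow> l"
    if C: "C \<in> \<C>" "S \<in> C" and l: "((\<lambda>i. avg (A i) (indicator S)) \<longlongrightarrow> l) F" for C S l
  proof (rule ccontr)
    assume "\<not> ?thesis"
    then obtain \<epsilon> where \<epsilon>: "0 < \<epsilon>"
      and not_ev: "\<not> eventually (\<lambda>i. \<bar>avg (a i) (indicator S) - l\<bar> < \<epsilon>) sequentially"
      unfolding tendsto_iff dist_real_def by blast
    define B where "B = {i. \<not> \<bar>avg (a i) (indicator S) - l\<bar> < \<epsilon>}"
    define F' where "F' = inf sequentially (principal B)"
    have "F' \<noteq> bot"
      using not_ev by (simp add: F'_def B_def trivial_limit_def eventually_inf_principal)
    obtain \<kappa> where \<kappa>: "mean \<kappa>" and near': "\<And>H \<epsilon>. finite H \<Longrightarrow> (\<And>h. h \<in> H \<Longrightarrow> bounded (range h)) \<Longrightarrow> 0 < \<epsilon> \<Longrightarrow>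
        frequently (\<lambda>i. \<forall>h\<in>H. \<bar>avg (a i) h - \<kappa> h\<bar> < \<epsilon>) F'"
      using cluster_mean[OF \<open>F' \<noteq> bot\<close>, of a] nonempty unfolding a_def by blast
    have agree: "\<kappa> h = \<nu> h" if "h \<in> G" for h
    proof (rule frequently_close_unique)
      show "((\<lambda>i. avg (a i) h) \<longlongrightarrow> \<nu> h) F'"
        using lim[OF that] unfolding F'_def by (rule tendsto_mono[rotated]) simp
    qed (use near'[of "{h}"] bG[OF that] in simp)
    obtain d where d: "\<And>J. finite J \<Longrightarrow> shatters C J \<Longrightarrow> card J \<le> d"
      using vc[OF C(1)] by blast
    have agree': "\<kappa> (tail_mean \<nu> C n J us k) = \<nu> (tail_mean \<nu> C n J us k)" if "finite J" for n J us k
      using C(1) that by (intro agree G)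
    have "\<nu> (indicator S) \<le> \<kappa> (indicator S)"
      by (rule mean_indicator_le[OF d \<nu> \<kappa> \<nu> agree' refl C(2)])
    moreover have "\<kappa> (indicator S) \<le> \<nu> (indicator S)"
      by (rule mean_indicator_le[OF d \<nu> \<nu> \<kappa> refl agree' C(2)])
    moreover have "\<nu> (indicator S) = l"
      by (rule frequently_close_unique[OF _ l]) (use near[of "{indicator S}"] in \<open>simp add: bounded_range_indicator\<close>)
    ultimately have "\<kappa> (indicator S) = l" by simp
    then have "frequently (\<lambda>i. \<bar>avg (a i) (indicator S) - l\<bar> < \<epsilon>) F'"
      using near'[of "{indicator S}" \<epsilon>] \<epsilon> by (simp add: bounded_range_indicator)
    moreover have "eventually (\<lambda>i. \<not> \<bar>avg (a i) (indicator S) - l\<bar> < \<epsilon>) F'"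
      by (simp add: F'_def B_def eventually_inf_principal)
    ultimately show False by (simp add: frequently_def)
  qed
  note converges = this
  show thesis
  proof (rule that[of a])
    show "a i \<noteq> []" for i by (simp add: a_def nonempty)
  qed (rule converges)
qed

section \<open>Definable relations\<close>

lemma trm_val_cong: "(\<And>i. i \<in> fv_trm t \<Longrightarrow> v i = w i) \<Longrightarrow> trm_val N v t = trm_val N w t"
proof (induction t)
  case (App f ts)
  have "map (trm_val N v) ts = map (trm_val N w) ts"
    by (rule map_cong[OF refl]) (use App in auto)
  then show ?case by (simp only: trm_val.simps)
qed auto

lemma sat_cong: "(\<And>i. i \<in> fv p \<Longrightarrow> v i = w i) \<Longrightarrow> sat N p v = sat N p w"
proof (induction p arbitrary: v w)
  case (Eq s t)
  then show ?case using trm_val_cong[of s v w N] trm_val_cong[of t v w N] by simp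
next
  case (Rel r ts)
  have "map (trm_val N v) ts = map (trm_val N w) ts"
    by (rule map_cong[OF refl], rule trm_val_cong) (use Rel in auto)
  then show ?case by (simp only: sat.simps)
next
  case (Neg p)
  have "sat N p v = sat N p w" by (rule Neg.IH) (use Neg.prems in auto)
  then show ?case by simp
next
  case (Conj p q)
  have "sat N p v = sat N p w" "sat N q v = sat N q w"
    by (rule Conj.IH; use Conj.prems in simp)+
  then show ?case by simp
next
  case (Exi i p)
  have "sat N p (v(i := c)) = sat N p (w(i := c))" for c
    by (rule Exi.IH) (use Exi.prems in simp)
  then show ?case by simp
qed simp

lemma finite_fv_trm: "finite (fv_trm t)"
  by (induction t) auto

lemma finite_fv: "finite (fv p)"
  by (induction p) (auto simp: finite_fv_trm)

text \<open>Working with relations on assignments instead of formulas makes it possible to rename variables and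
  to plug in parameters without a substitution operation on syntax.\<close>

definition definable ::
  "('f, 'r) language \<Rightarrow> ('f, 'r, 'u) struct \<Rightarrow> 'u set \<Rightarrow> nat set \<Rightarrow> ((nat \<Rightarrow> 'u) \<Rightarrow> bool) \<Rightarrow> bool" where
  "definable L U A V P \<longleftrightarrow> (\<exists>p\<in>formulas L V A. \<forall>v. v ` V \<subseteq> univ U \<longrightarrow> sat U p v = P v)"

lemma definable_sat: "p \<in> formulas L V A \<Longrightarrow> definable L U A V (sat U p)"
  unfolding definable_def by blast

lemma definable_cong:
  assumes "definable L U A V P" "V \<subseteq> V'" "A \<subseteq> A'" "\<And>v. v ` V' \<subseteq> univ U \<Longrightarrow> P v = Q v"
  shows "definable L U A' V' Q"
proof -
  obtain p where p: "p \<in> formulas L V A" "\<And>v. v ` V \<subseteq> univ U \<Longrightarrow> sat U p v = P v"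
    using assms(1) by (auto simp: definable_def)
  have trm: "wf_trm L A' t" if "wf_trm L A t" for t :: "('a, 'c) trm"
    using that assms(3) by (induction t) auto
  have "wf_fm L A' p" if "wf_fm L A p" for p :: "('a, 'b, 'c) fm"
    using that trm by (induction p) auto
  then have "p \<in> formulas L V' A'"
    using p(1) assms(2) by (auto simp: formulas_def)
  moreover have "sat U p v = Q v" if "v ` V' \<subseteq> univ U" for v
    using p(2)[of v] assms(2,4) that by (metis image_mono subset_trans)
  ultimately show ?thesis unfolding definable_def by blast
qed

lemma definable_True: "definable L U A V (\<lambda>_. True)"
  unfolding definable_def by (rule bexI[of _ Top]) (auto simp: formulas_def)

lemma definable_Not:
  assumes "definable L U A V P" shows "definable L U A V (\<lambda>v. \<not> P v)"
proof -
  obtain p where "p \<in> formulas L V A" "\<And>v. v ` V \<subseteq> univ U \<Longrightarrow> sat U p v = P v"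
    using assms by (auto simp: definable_def)
  then show ?thesis unfolding definable_def by (intro bexI[of _ "Neg p"]) (auto simp: formulas_def)
qed

lemma definable_conj:
  assumes "definable L U A V P" "definable L U A V Q" shows "definable L U A V (\<lambda>v. P v \<and> Q v)"
proof -
  obtain p q where "p \<in> formulas L V A" "\<And>v. v ` V \<subseteq> univ U \<Longrightarrow> sat U p v = P v"
    "q \<in> formulas L V A" "\<And>v. v ` V \<subseteq> univ U \<Longrightarrow> sat U q v = Q v"
    using assms by (auto simp: definable_def)
  then show ?thesis unfolding definable_def by (intro bexI[of _ "Conj p q"]) (auto simp: formulas_def)
qed

lemma definable_ball:
  assumes "finite S" "\<And>s. s \<in> S \<Longrightarrow> definable L U A V (P s)"
  shows "definable L U A V (\<lambda>v. \<forall>s\<in>S. P s v)"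
  using assms by (induction S rule: finite_induct) (auto intro: definable_True definable_conj)

lemma definable_iff_const:
  "definable L U A V P \<Longrightarrow> definable L U A V (\<lambda>v. P v \<longleftrightarrow> b)"
  by (cases b) (auto intro: definable_Not)

lemma definable_eq_var: "i \<in> V \<Longrightarrow> j \<in> V \<Longrightarrow> definable L U A V (\<lambda>v. v i = v j)"
  unfolding definable_def by (rule bexI[of _ "Eq (Var i) (Var j)"]) (auto simp: formulas_def)

lemma definable_eq_par: "i \<in> V \<Longrightarrow> c \<in> A \<Longrightarrow> definable L U A V (\<lambda>v. v i = c)"
  unfolding definable_def by (rule bexI[of _ "Eq (Var i) (Par c)"]) (auto simp: formulas_def)

lemma definable_ex:
  assumes "definable L U A V P"
  shows "definable L U A (V - {i}) (\<lambda>v. \<exists>c\<in>univ U. P (v(i := c)))"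
proof -
  obtain p where p: "p \<in> formulas L V A" "\<And>v. v ` V \<subseteq> univ U \<Longrightarrow> sat U p v = P v"
    using assms by (auto simp: definable_def)
  have "(v(i := c)) ` V \<subseteq> univ U" if "v ` (V - {i}) \<subseteq> univ U" "c \<in> univ U" for v c
    using that by auto
  then show ?thesis
    unfolding definable_def using p by (intro bexI[of _ "Exi i p"]) (auto simp: formulas_def)
qed

lemma definable_ex_block:
  assumes "finite F" "definable L U A V P"
  shows "definable L U A (V - F) (\<lambda>v. \<exists>f\<in>F \<rightarrow> univ U. P (override_on v f F))"
  using assms(1)
proof (induction F rule: finite_induct)
  case empty
  then show ?case using assms(2) by simp
next
  case (insert i F)
  have eq: "override_on (v(i := c)) f F = override_on v (f(i := c)) (insert i F)" for v f and c :: 'c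
    using insert.hyps by (auto simp: override_on_def)
  have "definable L U A (V - F - {i})
      (\<lambda>v. \<exists>c\<in>univ U. \<exists>f\<in>F \<rightarrow> univ U. P (override_on (v(i := c)) f F))"
    by (rule definable_ex[OF insert.IH])
  then show ?case
  proof (rule definable_cong)
    fix v :: "nat \<Rightarrow> 'c"
    show "(\<exists>c\<in>univ U. \<exists>f\<in>F \<rightarrow> univ U. P (override_on (v(i := c)) f F)) =
        (\<exists>f\<in>insert i F \<rightarrow> univ U. P (override_on v f (insert i F)))" (is "?l = ?r")
    proof
      assume ?l
      then obtain c f where *: "c \<in> univ U" "f \<in> F \<rightarrow> univ U" "P (override_on (v(i := c)) f F)" by blast
      then show ?r using insert.hyps unfolding eq by (intro bexI[of _ "f(i := c)"]) auto
    next
      assume ?r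
      then obtain f where f: "f \<in> insert i F \<rightarrow> univ U" "P (override_on v f (insert i F))" by blast
      then have "P (override_on (v(i := f i)) f F)" unfolding eq by simp
      then show ?l using f(1) by (intro bexI[of _ "f i"] bexI[of _ f]) auto
    qed
  qed auto
qed

text \<open>Substitution of \<open>s\<close> for the variables \<open>x\<close>, expressed as \<open>\<exists>x. x = s \<and> P\<close>. No capture can occur,
  since \<open>s\<close> is not placed under the quantifiers of \<open>P\<close>.\<close>

lemma definable_substitution:
  assumes "finite x" "x \<inter> V = {}" "definable L U A (x \<union> V) P"
    and eq: "\<And>i. i \<in> x \<Longrightarrow> definable L U A (x \<union> V) (\<lambda>v. v i = s i v)"
    and s: "\<And>i v w. i \<in> x \<Longrightarrow> (\<And>j. j \<in> V \<Longrightarrow> v j = w j) \<Longrightarrow> s i v = s i w"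
    and s_univ: "\<And>i v. i \<in> x \<Longrightarrow> v ` V \<subseteq> univ U \<Longrightarrow> s i v \<in> univ U"
  shows "definable L U A V (\<lambda>v. P (override_on v (\<lambda>i. s i v) x))"
proof -
  have "definable L U A (x \<union> V - x) (\<lambda>v. \<exists>f\<in>x \<rightarrow> univ U.
      (\<forall>i\<in>x. override_on v f x i = s i (override_on v f x)) \<and> P (override_on v f x))"
    using assms(1,3) eq
    by (intro definable_ex_block[where P = "\<lambda>v. (\<forall>i\<in>x. v i = s i v) \<and> P v"] definable_conj definable_ball)
  then show ?thesis
  proof (rule definable_cong)
    fix v assume v: "v ` V \<subseteq> univ U"
    have s': "s i (override_on v f x) = s i v" if "i \<in> x" for f i
      by (rule s[OF that]) (use assms(2) in \<open>auto simp: override_on_def\<close>)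
    have same: "override_on v f x = override_on v (\<lambda>i. s i v) x"
      if "\<forall>i\<in>x. override_on v f x i = s i (override_on v f x)" for f
    proof
      fix i show "override_on v f x i = override_on v (\<lambda>i. s i v) x i"
        using that by (cases "i \<in> x") (simp_all add: s')
    qed
    show "(\<exists>f\<in>x \<rightarrow> univ U. (\<forall>i\<in>x. override_on v f x i = s i (override_on v f x)) \<and> P (override_on v f x))
      = P (override_on v (\<lambda>i. s i v) x)"
    proof
      assume "P (override_on v (\<lambda>i. s i v) x)"
      moreover have "(\<lambda>i. s i v) \<in> x \<rightarrow> univ U"
        using s_univ v by auto
      ultimately show "\<exists>f\<in>x \<rightarrow> univ U. (\<forall>i\<in>x. override_on v f x i = s i (override_on v f x)) \<and> P (override_on v f x)"
        by (intro bexI[of _ "\<lambda>i. s i v"]) (simp_all add: s')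
    qed (use same in auto)
  qed (use assms(2) in auto)
qed

lemma saturated_realizes:
  fixes P :: "nat \<Rightarrow> (nat \<Rightarrow> 'u) \<Rightarrow> bool" and \<kappa> :: "'k rel"
  assumes sat: "saturated L \<kappa> U" and \<kappa>: "natLeq <o \<kappa>" and A: "A \<subseteq> univ U" "countable A" and x: "finite x"
    and def: "\<And>k. definable L U A x (P k)" and fin: "\<And>n. \<exists>a\<in>tuples U x. \<forall>k<n. P k a"
  obtains a where "a \<in> tuples U x" "\<And>k. P k a"
proof -
  have "\<forall>k. \<exists>p\<in>formulas L x A. \<forall>v. v ` x \<subseteq> univ U \<longrightarrow> sat U p v = P k v"
    using def by (simp add: definable_def)
  then obtain p where p: "\<And>k. p k \<in> formulas L x A" "\<And>k v. v ` x \<subseteq> univ U \<Longrightarrow> sat U (p k) v = P k v"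
    by metis
  have p_iff: "sat U (p k) a = P k a" if "a \<in> tuples U x" for k a
    using that by (intro p(2)) auto
  have "|A| <o \<kappa>"
  proof -
    have "|A| \<le>o |UNIV :: nat set|"
      using A(2) unfolding countable_def by (intro card_of_ordLeq[THEN iffD1]) auto
    then show ?thesis
      using card_of_nat \<kappa> ordLeq_ordIso_trans ordLeq_ordLess_trans by blast
  qed
  moreover have "\<exists>a\<in>tuples U x. \<forall>q\<in>\<Sigma>\<^sub>0. sat U q a" if sub: "\<Sigma>\<^sub>0 \<subseteq> range p" and fin0: "finite \<Sigma>\<^sub>0" for \<Sigma>\<^sub>0
  proof -
    obtain K where K: "finite K" "\<Sigma>\<^sub>0 = p ` K"
      using finite_subset_image[OF fin0 sub] by blast
    then obtain n where "\<forall>k\<in>K. k < n"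
      using finite_nat_set_iff_bounded by blast
    moreover obtain a where "a \<in> tuples U x" "\<forall>k<n. P k a" using fin by blast
    ultimately show ?thesis using K(2) p_iff by blast
  qed
  ultimately have "\<exists>a\<in>tuples U x. \<forall>q\<in>range p. sat U q a"
    using sat A(1) x p(1) unfolding saturated_def by (metis (no_types, lifting) image_subsetI)
  then show thesis using that p_iff by auto
qed

section \<open>NIP and finite VC dimension\<close>

definition seq_shattered ::
  "('f, 'r, 'u) struct \<Rightarrow> nat set \<Rightarrow> nat set \<Rightarrow> ('f, 'r, 'u) fm \<Rightarrow> nat \<Rightarrow> (nat \<Rightarrow> nat \<Rightarrow> 'u) \<Rightarrow> bool" where
  "seq_shattered U x y p n a \<longleftrightarrow>
     (\<forall>I\<subseteq>{..<n}. \<exists>b\<in>tuples U y. \<forall>j<n. sat U p (override_on b (a j) x) \<longleftrightarrow> j \<in> I)"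

text \<open>The invariant of building a shattered sequence entry by entry: for a sequence that is merely
  shattered itself, there may be no next entry.\<close>

definition extendible ::
  "('f, 'r, 'u) struct \<Rightarrow> nat set \<Rightarrow> nat set \<Rightarrow> ('f, 'r, 'u) fm \<Rightarrow> nat \<Rightarrow> (nat \<Rightarrow> nat \<Rightarrow> 'u) \<Rightarrow> bool" where
  "extendible U x y p n a \<longleftrightarrow>
     (\<forall>k. \<exists>a'. (\<forall>j<n + k. a' j \<in> tuples U x) \<and> (\<forall>j<n. a' j = a j) \<and> seq_shattered U x y p (n + k) a')"

lemma seq_shattered_mono:
  assumes "seq_shattered U x y p n a" "m \<le> n"
  shows "seq_shattered U x y p m a"
  unfolding seq_shattered_def
proof (intro allI impI)
  fix I assume "I \<subseteq> {..<m}"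
  then have "I \<subseteq> {..<n}" using assms(2) by auto
  then show "\<exists>b\<in>tuples U y. \<forall>j<m. sat U p (override_on b (a j) x) = (j \<in> I)"
    using assms unfolding seq_shattered_def by (meson order_less_le_trans)
qed

lemma seq_shattered_cong:
  "(\<And>j. j < n \<Longrightarrow> a j = b j) \<Longrightarrow> seq_shattered U x y p n a = seq_shattered U x y p n b"
  unfolding seq_shattered_def by simp

text \<open>Fresh copies of the variables of \<open>x\<close>, above all variables of the formula, so that several tuples
  can be quantified in one formula.\<close>

definition copy_var :: "nat \<Rightarrow> nat \<Rightarrow> nat \<Rightarrow> nat" where
  "copy_var N j i = N + prod_encode (j, i)"

definition copy_vars :: "nat \<Rightarrow> nat set \<Rightarrow> nat \<Rightarrow> nat set" where
  "copy_vars N x n = (\<lambda>(j, i). copy_var N j i) ` ({..<n} \<times> x)"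

lemma copy_var_inject [simp]: "copy_var N j i = copy_var N j' i' \<longleftrightarrow> j = j' \<and> i = i'"
  by (simp add: copy_var_def)

lemma copy_var_in_copy_vars: "j < n \<Longrightarrow> i \<in> x \<Longrightarrow> copy_var N j i \<in> copy_vars N x n"
  by (auto simp: copy_vars_def)

lemma finite_copy_vars: "finite x \<Longrightarrow> finite (copy_vars N x n)"
  by (simp add: copy_vars_def)

lemma copy_vars_disjoint: "V \<subseteq> {..<N} \<Longrightarrow> V \<inter> copy_vars N x n = {}"
  by (auto simp: copy_vars_def copy_var_def)

lemma definable_seq_shattered:
  assumes "finite x" "finite y" "x \<inter> y = {}" "x \<union> y \<subseteq> {..<N}" "p \<in> formulas L (x \<union> y) {}"
  shows "definable L U {} (copy_vars N x n)
    (\<lambda>v. seq_shattered U x y p n (\<lambda>j. restrict (\<lambda>i. v (copy_var N j i)) x))"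
proof -
  let ?W = "copy_vars N x n"
  let ?Q = "\<lambda>j v. sat U p (override_on v (\<lambda>i. v (copy_var N j i)) x)"
  have disj: "(x \<union> y) \<inter> ?W = {}"
    using assms(4) by (rule copy_vars_disjoint)
  have Q: "definable L U {} (y \<union> ?W) (?Q j)" if "j < n" for j
  proof (rule definable_substitution)
    show "definable L U {} (x \<union> (y \<union> ?W)) (sat U p)"
      by (rule definable_cong[OF definable_sat[OF assms(5)]]) auto
    show "definable L U {} (x \<union> (y \<union> ?W)) (\<lambda>v. v i = v (copy_var N j i))" if "i \<in> x" for i
      using that \<open>j < n\<close> by (intro definable_eq_var) (auto intro: copy_var_in_copy_vars)
  qed (use assms disj \<open>j < n\<close> in \<open>auto intro: copy_var_in_copy_vars\<close>)
  have "definable L U {} (y \<union> ?W - y)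
      (\<lambda>v. \<exists>b\<in>y \<rightarrow> univ U. \<forall>j\<in>{..<n}. ?Q j (override_on v b y) = (j \<in> I))" for I
    using Q by (intro definable_ex_block[where P = "\<lambda>v. \<forall>j\<in>{..<n}. ?Q j v = (j \<in> I)"] definable_ball
        definable_iff_const assms) auto
  then have "definable L U {} (y \<union> ?W - y) (\<lambda>v. \<forall>I\<in>Pow {..<n}.
      \<exists>b\<in>y \<rightarrow> univ U. \<forall>j\<in>{..<n}. ?Q j (override_on v b y) = (j \<in> I))"
    by (intro definable_ball) auto
  then show ?thesis
  proof (rule definable_cong)
    fix v :: "nat \<Rightarrow> 'c"
    have val: "?Q j (override_on v b y) =
        sat U p (override_on (restrict b y) (restrict (\<lambda>i. v (copy_var N j i)) x) x)" if "j < n" for j b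
    proof (rule sat_cong)
      fix i assume "i \<in> fv p"
      then have "i \<in> x \<union> y" using assms(5) by (auto simp: formulas_def)
      moreover have "copy_var N j i \<notin> y" if "i \<in> x"
        using disj copy_var_in_copy_vars[OF \<open>j < n\<close> that] by auto
      ultimately show "override_on (override_on v b y) (\<lambda>i. override_on v b y (copy_var N j i)) x i =
          override_on (restrict b y) (restrict (\<lambda>i. v (copy_var N j i)) x) x i"
        by (auto simp: override_on_def)
    qed
    have ex: "(\<exists>b\<in>y \<rightarrow> univ U. R (restrict b y)) = (\<exists>b\<in>tuples U y. R b)" for R
    proof
      assume "\<exists>b\<in>tuples U y. R b"
      then obtain b where "b \<in> tuples U y" "R b" by blast
      then show "\<exists>b\<in>y \<rightarrow> univ U. R (restrict b y)"
        by (intro bexI[of _ b]) (auto simp: PiE_restrict PiE_iff)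
    next
      assume "\<exists>b\<in>y \<rightarrow> univ U. R (restrict b y)"
      then obtain b where "b \<in> y \<rightarrow> univ U" "R (restrict b y)" by blast
      then show "\<exists>b\<in>tuples U y. R b"
        by (intro bexI[of _ "restrict b y"]) (auto simp: restrict_PiE_iff)
    qed
    have "(\<exists>b\<in>y \<rightarrow> univ U. \<forall>j\<in>{..<n}. ?Q j (override_on v b y) = (j \<in> I)) =
      (\<exists>b\<in>tuples U y. \<forall>j\<in>{..<n}. sat U p (override_on b (restrict (\<lambda>i. v (copy_var N j i)) x) x) = (j \<in> I))" for I
      unfolding ex[symmetric] by (intro bex_cong refl ball_cong) (simp add: val)
    then show "(\<forall>I\<in>Pow {..<n}. \<exists>b\<in>y \<rightarrow> univ U. \<forall>j\<in>{..<n}. ?Q j (override_on v b y) = (j \<in> I)) =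
      seq_shattered U x y p n (\<lambda>j. restrict (\<lambda>i. v (copy_var N j i)) x)"
      unfolding seq_shattered_def by (simp add: Ball_def)
  qed auto
qed

text \<open>The type of a next entry of the sequence consists of these relations for all \<open>k\<close>. The entries
  already chosen enter as parameters, all others as quantified copies of \<open>x\<close>.\<close>

lemma definable_extension:
  assumes "finite x" "finite y" "x \<inter> y = {}" "p \<in> formulas L (x \<union> y) {}"
    and a: "\<And>j. j < n \<Longrightarrow> a j \<in> tuples U x"
  shows "definable L U (\<Union>j<n. a j ` x) x (\<lambda>c. \<exists>a'. (\<forall>j<Suc n + k. a' j \<in> tuples U x) \<and>
    (\<forall>j<n. a' j = a j) \<and> a' n = restrict c x \<and> seq_shattered U x y p (Suc n + k) a')"
proof -
  obtain N where N: "x \<union> y \<subseteq> {..<N}"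
    using assms(1,2) by (metis finite_Un finite_nat_iff_bounded)
  define m where "m = Suc n + k"
  have less_m: "n < m" "\<And>j. j < n \<Longrightarrow> j < m" by (simp_all add: m_def)
  let ?A = "\<Union>j<n. a j ` x"
  let ?W = "copy_vars N x m"
  let ?t = "\<lambda>v j. restrict (\<lambda>i. v (copy_var N j i)) x"
  let ?P = "\<lambda>v. ((\<forall>j\<in>{..<n}. \<forall>i\<in>x. v (copy_var N j i) = a j i) \<and> (\<forall>i\<in>x. v (copy_var N n i) = v i)) \<and> seq_shattered U x y p m (?t v)"
  have disj: "x \<inter> ?W = {}"
    using N by (intro copy_vars_disjoint) auto
  have "definable L U ?A (x \<union> ?W) ?P"
  proof (intro definable_conj definable_ball definable_eq_var definable_eq_par)
    show "definable L U ?A (x \<union> ?W) (\<lambda>v. seq_shattered U x y p m (?t v))"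
      by (rule definable_cong[OF definable_seq_shattered[OF assms(1-3) N assms(4)]]) auto
  qed (use assms(1) in \<open>auto intro: copy_var_in_copy_vars less_m\<close>)
  then have "definable L U ?A (x \<union> ?W - ?W) (\<lambda>v. \<exists>f\<in>?W \<rightarrow> univ U. ?P (override_on v f ?W))"
    by (rule definable_ex_block[OF finite_copy_vars[OF assms(1)]])
  then show ?thesis
    unfolding m_def[symmetric]
  proof (rule definable_cong)
    fix c assume c: "c ` x \<subseteq> univ U"
    have val: "override_on c f ?W (copy_var N j i) = f (copy_var N j i)" if "j < m" "i \<in> x" for f j i
      using copy_var_in_copy_vars[OF that] by (simp add: override_on_def)
    have val': "override_on c f ?W i = c i" if "i \<in> x" for f i
      using disj that by (auto simp: override_on_def)
    have tup: "?t (override_on c f ?W) j = ?t f j" if "j < m" for f j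
      using val[OF that] by (auto simp: restrict_def)
    have sh: "seq_shattered U x y p m (?t (override_on c f ?W)) = seq_shattered U x y p m (?t f)" for f
      by (rule seq_shattered_cong) (rule tup)
    have P: "?P (override_on c f ?W) \<longleftrightarrow>
        ((\<forall>j\<in>{..<n}. \<forall>i\<in>x. f (copy_var N j i) = a j i) \<and> (\<forall>i\<in>x. f (copy_var N n i) = c i)) \<and>
        seq_shattered U x y p m (?t f)" for f
      unfolding sh by (intro arg_cong2[of _ _ _ _ "(\<and>)"] ball_cong refl) (simp_all add: val val' less_m)
    show "(\<exists>f\<in>?W \<rightarrow> univ U. ?P (override_on c f ?W)) =
      (\<exists>a'. (\<forall>j<m. a' j \<in> tuples U x) \<and> (\<forall>j<n. a' j = a j) \<and> a' n = restrict c x \<and>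
        seq_shattered U x y p m a')" (is "?l = ?r")
    proof
      assume ?l
      then obtain f where f: "f \<in> ?W \<rightarrow> univ U" "\<forall>j\<in>{..<n}. \<forall>i\<in>x. f (copy_var N j i) = a j i"
        "\<forall>i\<in>x. f (copy_var N n i) = c i" "seq_shattered U x y p m (?t f)"
        unfolding P by blast
      have "\<forall>j<m. ?t f j \<in> tuples U x"
        using f(1) by (auto intro: copy_var_in_copy_vars)
      moreover have "\<forall>j<n. ?t f j = a j"
      proof (intro allI impI ext)
        fix j i assume "j < n"
        then show "?t f j i = a j i"
          using f(2) PiE_arb[OF a[OF \<open>j < n\<close>]] by (cases "i \<in> x") auto
      qed
      moreover have "?t f n = restrict c x"
        using f(3) by (auto simp: restrict_def)
      ultimately show ?r using f(4) by (intro exI[of _ "?t f"] conjI)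
    next
      assume ?r
      then obtain a' where a': "\<forall>j<m. a' j \<in> tuples U x" "\<forall>j<n. a' j = a j" "a' n = restrict c x"
        "seq_shattered U x y p m a'" by blast
      define f where "f w = (case prod_decode (w - N) of (j, i) \<Rightarrow> a' j i)" for w
      have f: "f (copy_var N j i) = a' j i" for j i
        by (simp add: f_def copy_var_def)
      have "f \<in> ?W \<rightarrow> univ U"
        using a'(1) by (auto simp: copy_vars_def f PiE_iff)
      moreover have "seq_shattered U x y p m (?t f)"
        using a'(1,4) by (subst seq_shattered_cong[of _ _ a']) (auto simp: f PiE_restrict)
      ultimately show ?l
        unfolding P using a'(2,3) by (intro bexI[of _ f]) (simp_all add: f)
    qed
  qed (use disj in auto)
qed

text \<open>The relations of \<open>definable_extension\<close> get stronger with \<open>k\<close>, so each finite set of them is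
  satisfied by the next entry of one long shattered sequence; saturation satisfies them all.\<close>

lemma extendible_step:
  fixes U :: "('f, 'r, 'u) struct" and \<kappa> :: "'k rel"
  assumes sat: "saturated L \<kappa> U" and \<kappa>: "natLeq <o \<kappa>"
    and fm: "finite x" "finite y" "x \<inter> y = {}" "p \<in> formulas L (x \<union> y) {}"
    and a: "\<And>j. j < n \<Longrightarrow> a j \<in> tuples U x" and ext: "extendible U x y p n a"
  obtains c where "c \<in> tuples U x" "extendible U x y p (Suc n) (a(n := c))"
proof -
  let ?P = "\<lambda>k c. \<exists>a'. (\<forall>j<Suc n + k. a' j \<in> tuples U x) \<and>
    (\<forall>j<n. a' j = a j) \<and> a' n = restrict c x \<and> seq_shattered U x y p (Suc n + k) a'"
  have fin: "\<exists>c\<in>tuples U x. \<forall>k<m. ?P k c" for m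
  proof -
    obtain a' where a': "\<forall>j<n + Suc m. a' j \<in> tuples U x" "\<forall>j<n. a' j = a j"
      "seq_shattered U x y p (n + Suc m) a'"
      using ext[unfolded extendible_def, rule_format, of "Suc m"] by (elim exE conjE)
    have "a' n \<in> tuples U x" using a'(1) by simp
    moreover from this have "restrict (a' n) x = a' n" by (rule PiE_restrict)
    then have "?P k (a' n)" if "k < m" for k
      using a' that seq_shattered_mono[OF a'(3), of "Suc n + k"]
      by (intro exI[of _ a']) auto
    ultimately show ?thesis by blast
  qed
  have "(\<Union>j<n. a j ` x) \<subseteq> univ U" "countable (\<Union>j<n. a j ` x)"
    using a fm(1) by (auto intro: countable_finite)
  from saturated_realizes[where P = ?P, OF sat \<kappa> this fm(1) definable_extension[OF fm a] fin]
  obtain c where c: "c \<in> tuples U x" "\<And>k. ?P k c" by blast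
  have "extendible U x y p (Suc n) (a(n := c))"
    unfolding extendible_def
  proof
    fix k
    obtain a' where "\<forall>j<Suc n + k. a' j \<in> tuples U x" "\<forall>j<n. a' j = a j" "a' n = restrict c x"
      "seq_shattered U x y p (Suc n + k) a'"
      using c(2)[of k] by (elim exE conjE)
    then show "\<exists>a'. (\<forall>j<Suc n + k. a' j \<in> tuples U x) \<and> (\<forall>j<Suc n. a' j = (a(n := c)) j) \<and>
        seq_shattered U x y p (Suc n + k) a'"
      using c(1) by (intro exI[of _ a']) (auto simp: PiE_restrict less_Suc_eq)
  qed
  with c(1) show thesis by (rule that)
qed

text \<open>Saturation is used twice. Over finitely many parameters it supplies the next entry of the sequence.
  In the end all initial segments of the sequence are shattered, and saturation over countably many
  parameters gives for every subset of the infinite sequence a single tuple \<open>b\<close> that cuts it out.\<close>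

lemma infinite_shattered:
  fixes U :: "('f, 'r, 'u) struct" and \<kappa> :: "'k rel"
  assumes sat: "saturated L \<kappa> U" and \<kappa>: "natLeq <o \<kappa>"
    and fm: "finite x" "finite y" "x \<inter> y = {}" "p \<in> formulas L (x \<union> y) {}"
    and large: "\<And>d. \<exists>J. finite J \<and> d < card J \<and> J \<subseteq> tuples U x \<and> shattered U x y p J"
  shows "\<exists>A\<subseteq>tuples U x. infinite A \<and> shattered U x y p A"
proof -
  have start: "extendible U x y p 0 a" for a
    unfolding extendible_def
  proof
    fix k
    obtain J where J: "finite J" "k < card J" "J \<subseteq> tuples U x" "shattered U x y p J"
      using large by blast
    obtain e where e: "bij_betw e {0..<card J} J"
      using ex_bij_betw_nat_finite[OF J(1)] by blast
    have eJ: "e j \<in> J" if "j < k" for j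
      using bij_betwE[OF e] that J(2) by auto
    have "seq_shattered U x y p k e"
      unfolding seq_shattered_def
    proof (intro allI impI)
      fix I assume I: "I \<subseteq> {..<k}"
      then have "e ` I \<subseteq> J" using eJ by auto
      then obtain b where b: "b \<in> tuples U y" "\<forall>a\<in>J. sat U p (override_on b a x) \<longleftrightarrow> a \<in> e ` I"
        using J(4)[unfolded shattered_def, rule_format, of "e ` I"] by blast
      have "e j \<in> e ` I \<longleftrightarrow> j \<in> I" if "j < k" for j
        by (rule inj_on_image_mem_iff[OF bij_betw_imp_inj_on[OF e]]) (use I J(2) that in auto)
      then show "\<exists>b\<in>tuples U y. \<forall>j<k. sat U p (override_on b (e j) x) = (j \<in> I)"
        using b eJ by (intro bexI[of _ b]) simp_all
    qed
    then show "\<exists>a'. (\<forall>j<0 + k. a' j \<in> tuples U x) \<and> (\<forall>j<0. a' j = a j) \<and> seq_shattered U x y p (0 + k) a'"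
      using eJ J(3) by (intro exI[of _ e]) auto
  qed
  have cong: "extendible U x y p n f = extendible U x y p n g" if "\<And>j. j < n \<Longrightarrow> f j = g j" for n f g
    using that unfolding extendible_def by auto
  have "\<exists>a. \<forall>n. a n \<in> tuples U x \<and> extendible U x y p (Suc n) (a(n := a n))"
  proof (rule dependent_wf_choice[where R = less_than and P = "\<lambda>f n c. c \<in> tuples U x \<and> extendible U x y p (Suc n) (f(n := c))"])
    fix f g :: "nat \<Rightarrow> nat \<Rightarrow> 'u" and n c
    assume "\<And>z. (z, n) \<in> less_than \<Longrightarrow> f z = g z"
    then show "(c \<in> tuples U x \<and> extendible U x y p (Suc n) (f(n := c))) =
      (c \<in> tuples U x \<and> extendible U x y p (Suc n) (g(n := c)))"
      using cong[of "Suc n" "f(n := c)" "g(n := c)"] by simp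
  next
    fix n and f :: "nat \<Rightarrow> nat \<Rightarrow> 'u"
    assume IH: "\<And>m. (m, n) \<in> less_than \<Longrightarrow> f m \<in> tuples U x \<and> extendible U x y p (Suc m) (f(m := f m))"
    have "extendible U x y p n f"
    proof (cases n)
      case (Suc m)
      then show ?thesis using IH[of m] by simp
    qed (simp add: start)
    then show "\<exists>c. c \<in> tuples U x \<and> extendible U x y p (Suc n) (f(n := c))"
      using extendible_step[OF sat \<kappa> fm, of n f] IH by (metis less_than_iff)
  qed (rule wf_less_than)
  then obtain a where a: "\<And>n. a n \<in> tuples U x" and ext: "\<And>n. extendible U x y p (Suc n) a"
    by auto
  have sh: "seq_shattered U x y p n a" for n
  proof -
    obtain a' where "\<forall>j<Suc n. a' j = a j" "seq_shattered U x y p (Suc n) a'"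
      using ext[of n, unfolded extendible_def, rule_format, of 0] unfolding add_0_right by (elim exE conjE)
    then have "seq_shattered U x y p (Suc n) a"
      using seq_shattered_cong[of "Suc n" a' a U x y p] by blast
    then show ?thesis by (rule seq_shattered_mono) simp
  qed
  have "inj a"
  proof (rule injI, rule ccontr)
    fix i j assume ij: "a i = a j" "i \<noteq> j"
    have "{i} \<subseteq> {..<Suc (max i j)}" by (simp add: less_Suc_eq_le)
    then obtain b where "\<forall>k<Suc (max i j). sat U p (override_on b (a k) x) \<longleftrightarrow> k \<in> {i}"
      using sh[of "Suc (max i j)", unfolded seq_shattered_def, rule_format, of "{i}"] by blast
    then have "sat U p (override_on b (a i) x)" "\<not> sat U p (override_on b (a j) x)"
      using ij(2) by (auto simp: less_Suc_eq_le)
    then show False using ij(1) by simp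
  qed
  then have "infinite (range a)"
    by (simp add: finite_image_iff)
  moreover have "shattered U x y p (range a)"
    unfolding shattered_def
  proof (intro allI impI)
    fix I assume "I \<subseteq> range a"
    let ?P = "\<lambda>j b. sat U p (override_on b (a j) x) \<longleftrightarrow> a j \<in> I"
    let ?A = "\<Union>j. a j ` x"
    have A: "?A \<subseteq> univ U" "countable ?A"
      using a fm(1) by (auto intro: countable_finite)
    have def: "definable L U ?A y (?P j)" for j
    proof (intro definable_iff_const definable_substitution)
      show "definable L U ?A (x \<union> y) (sat U p)"
        by (rule definable_cong[OF definable_sat[OF fm(4)]]) auto
      show "definable L U ?A (x \<union> y) (\<lambda>v. v i = a j i)" if "i \<in> x" for i
        using that by (intro definable_eq_par) auto
    qed (use fm a[of j] in auto)
    have "\<exists>b\<in>tuples U y. \<forall>j<n. ?P j b" for n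
    proof -
      have "{j. j < n \<and> a j \<in> I} \<subseteq> {..<n}" by auto
      then obtain b where "b \<in> tuples U y"
        "\<forall>j<n. sat U p (override_on b (a j) x) \<longleftrightarrow> j \<in> {j. j < n \<and> a j \<in> I}"
        using sh[of n, unfolded seq_shattered_def, rule_format, of "{j. j < n \<and> a j \<in> I}"] by blast
      then show ?thesis by auto
    qed
    then obtain b where "b \<in> tuples U y" "\<And>j. ?P j b"
      by (rule saturated_realizes[where P = ?P, OF sat \<kappa> A fm(2) def]) (rule that)
    then show "\<exists>b\<in>tuples U y. \<forall>a\<in>range a. sat U p (override_on b a x) = (a \<in> I)"
      by (intro bexI[of _ b]) simp_all
  qed
  moreover have "range a \<subseteq> tuples U x" using a by auto
  ultimately show ?thesis by (intro exI[of _ "range a"] conjI)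
qed

section \<open>Parameters as variables\<close>

fun par_to_var_trm :: "('u \<Rightarrow> nat) \<Rightarrow> ('f, 'u) trm \<Rightarrow> ('f, 'u) trm" where
  "par_to_var_trm g (Var i) = Var i"
| "par_to_var_trm g (Par c) = Var (g c)"
| "par_to_var_trm g (App f ts) = App f (map (par_to_var_trm g) ts)"

fun par_to_var :: "('u \<Rightarrow> nat) \<Rightarrow> ('f, 'r, 'u) fm \<Rightarrow> ('f, 'r, 'u) fm" where
  "par_to_var g Bot = Bot"
| "par_to_var g (Eq s t) = Eq (par_to_var_trm g s) (par_to_var_trm g t)"
| "par_to_var g (Rel r ts) = Rel r (map (par_to_var_trm g) ts)"
| "par_to_var g (Neg p) = Neg (par_to_var g p)"
| "par_to_var g (Conj p q) = Conj (par_to_var g p) (par_to_var g q)"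
| "par_to_var g (Exi i p) = Exi i (par_to_var g p)"

fun bv :: "('f, 'r, 'u) fm \<Rightarrow> nat set" where
  "bv (Neg p) = bv p"
| "bv (Conj p q) = bv p \<union> bv q"
| "bv (Exi i p) = insert i (bv p)"
| "bv _ = {}"

lemma finite_bv: "finite (bv p)"
  by (induction p) auto

lemma finite_set2_trm: "finite (set2_trm t)"
  by (induction t) auto

lemma finite_set3_fm: "finite (set3_fm p)"
  by (induction p) (auto simp: finite_set2_trm)

lemma trm_val_par_to_var:
  "(\<And>c. c \<in> set2_trm t \<Longrightarrow> v (g c) = c) \<Longrightarrow> trm_val N v (par_to_var_trm g t) = trm_val N v t"
proof (induction t)
  case (App f ts)
  have "map (trm_val N v) (map (par_to_var_trm g) ts) = map (trm_val N v) ts"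
    unfolding map_map by (rule map_cong[OF refl]) (use App in auto)
  then show ?case by (simp only: trm_val.simps par_to_var_trm.simps)
qed auto

text \<open>The new variables must not be captured by quantifiers of the formula, which is why its bound
  variables are collected by \<open>bv\<close>.\<close>

lemma sat_par_to_var:
  assumes "\<And>c. c \<in> set3_fm p \<Longrightarrow> v (g c) = c" "\<And>c. c \<in> set3_fm p \<Longrightarrow> g c \<notin> bv p"
  shows "sat N (par_to_var g p) v = sat N p v"
  using assms
proof (induction p arbitrary: v)
  case (Eq s t)
  then show ?case using trm_val_par_to_var[of s v g N] trm_val_par_to_var[of t v g N] by simp
next
  case (Rel r ts)
  have "map (trm_val N v) (map (par_to_var_trm g) ts) = map (trm_val N v) ts"
    unfolding map_map o_def by (rule map_cong[OF refl], rule trm_val_par_to_var) (use Rel.prems(1) in auto)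
  then show ?case by (simp only: sat.simps par_to_var.simps)
next
  case (Neg p)
  have "sat N (par_to_var g p) v = sat N p v" by (rule Neg.IH) (use Neg.prems in auto)
  then show ?case by simp
next
  case (Conj p q)
  have "sat N (par_to_var g p) v = sat N p v" by (rule Conj.IH(1)) (use Conj.prems in auto)
  moreover have "sat N (par_to_var g q) v = sat N q v" by (rule Conj.IH(2)) (use Conj.prems in auto)
  ultimately show ?case by simp
next
  case (Exi i p)
  have "sat N (par_to_var g p) (v(i := c)) = sat N p (v(i := c))" for c
    by (rule Exi.IH) (use Exi.prems in auto)
  then show ?case by simp
qed simp

lemma wf_par_to_var_trm: "wf_trm L A t \<Longrightarrow> wf_trm L B (par_to_var_trm g t)"
  by (induction t) auto

lemma wf_par_to_var: "wf_fm L A p \<Longrightarrow> wf_fm L B (par_to_var g p)"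
  by (induction p) (auto intro: wf_par_to_var_trm)

lemma fv_par_to_var_trm: "fv_trm (par_to_var_trm g t) \<subseteq> fv_trm t \<union> g ` set2_trm t"
proof (induction t)
  case (App f ts)
  then show ?case by fastforce
qed auto

lemma fv_par_to_var: "fv (par_to_var g p) \<subseteq> fv p \<union> g ` set3_fm p"
proof (induction p)
  case (Eq s t)
  then show ?case using fv_par_to_var_trm[of g s] fv_par_to_var_trm[of g t] by auto
next
  case (Rel r ts)
  then show ?case using fv_par_to_var_trm[of g] by fastforce
qed auto

lemma params_trm: "wf_trm L A t \<Longrightarrow> set2_trm t \<subseteq> A"
  by (induction t) auto

lemma params_fm: "wf_fm L A p \<Longrightarrow> set3_fm p \<subseteq> A"
proof (induction p)
  case (Eq s t)
  then show ?case using params_trm[of L A s] params_trm[of L A t] by auto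
next
  case (Rel r ts)
  then show ?case using params_trm[of L A] by fastforce
qed auto

lemma formula_as_instance:
  fixes U :: "('f, 'r, 'u) struct"
  assumes "finite x" "\<psi> \<in> formulas L x (univ U)"
  obtains \<phi> b where "\<phi> \<in> formulas L UNIV {}" "b \<in> tuples U (fv \<phi> - x)"
    "\<And>a. sat U \<psi> a \<longleftrightarrow> sat U \<phi> (override_on b a x)"
proof -
  obtain g :: "'u \<Rightarrow> nat" where g: "inj_on g (set3_fm \<psi>)" "g ` set3_fm \<psi> \<inter> (bv \<psi> \<union> x) = {}"
  proof -
    obtain h :: "'u \<Rightarrow> nat" where h: "inj_on h (set3_fm \<psi>)"
      using countable_finite[OF finite_set3_fm[of \<psi>]] unfolding countable_def by (elim exE)
    obtain N where N: "bv \<psi> \<union> x \<subseteq> {..<N}"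
      using finite_bv assms(1) by (metis finite_Un finite_nat_iff_bounded)
    have "inj_on (\<lambda>c. N + h c) (set3_fm \<psi>)" using h by (simp add: inj_on_def)
    moreover have "(\<lambda>c. N + h c) ` set3_fm \<psi> \<inter> (bv \<psi> \<union> x) = {}" using N by auto
    ultimately show thesis by (rule that)
  qed
  define \<phi> where "\<phi> = par_to_var g \<psi>"
  define b where "b = inv_into (set3_fm \<psi>) g"
  have b: "b (g c) = c" if "c \<in> set3_fm \<psi>" for c
    unfolding b_def using g(1) that by (rule inv_into_f_f)
  have wf: "wf_fm L (univ U) \<psi>" and fv: "fv \<psi> \<subseteq> x"
    using assms(2) by (auto simp: formulas_def)
  have fv_\<phi>: "fv \<phi> - x \<subseteq> g ` set3_fm \<psi>"
    using fv_par_to_var[of g \<psi>] fv unfolding \<phi>_def by blast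
  have b_univ: "b i \<in> univ U" if i: "i \<in> fv \<phi> - x" for i
  proof -
    obtain c where "c \<in> set3_fm \<psi>" "i = g c" using fv_\<phi> i by blast
    then show ?thesis using b params_fm[OF wf] by auto
  qed
  show thesis
  proof (rule that)
    show "\<phi> \<in> formulas L UNIV {}"
      using wf_par_to_var[OF wf] by (simp add: formulas_def \<phi>_def)
    show "restrict b (fv \<phi> - x) \<in> tuples U (fv \<phi> - x)"
      using b_univ by (simp add: restrict_PiE_iff)
    fix a
    have "sat U \<psi> a = sat U \<psi> (override_on b a x)"
      by (rule sat_cong) (use fv in auto)
    also have "\<dots> = sat U \<phi> (override_on b a x)"
      unfolding \<phi>_def
    proof (rule sat_par_to_var[symmetric])
      fix c assume "c \<in> set3_fm \<psi>"
      moreover from this have "g c \<notin> x" "g c \<notin> bv \<psi>" using g(2) by auto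
      ultimately show "override_on b a x (g c) = c" "g c \<notin> bv \<psi>" by (simp_all add: b)
    qed
    also have "\<dots> = sat U \<phi> (override_on (restrict b (fv \<phi> - x)) a x)"
      by (rule sat_cong) (auto simp: override_on_def)
    finally show "sat U \<psi> a \<longleftrightarrow> sat U \<phi> (override_on (restrict b (fv \<phi> - x)) a x)" .
  qed
qed

instance trm :: (countable, countable) countable
  by countable_datatype

instance fm :: (countable, countable, countable) countable
  by countable_datatype

lemma symbols_trm: "wf_trm L A t \<Longrightarrow> set1_trm t \<subseteq> funs L"
  by (induction t) auto

lemma symbols_fm: "wf_fm L A p \<Longrightarrow> set1_fm p \<subseteq> funs L \<and> set2_fm p \<subseteq> rels L"
proof (induction p)
  case (Eq s t)
  then show ?case using symbols_trm[of L A s] symbols_trm[of L A t] by auto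
next
  case (Rel r ts)
  then show ?case using symbols_trm[of L A] by fastforce
qed auto

text \<open>A countable language may live on uncountable types of symbols, so the formulas are mapped injectively
  to formulas over natural numbers.\<close>

lemma countable_formulas:
  fixes L :: "('f, 'r) language"
  assumes "countable_language L"
  shows "countable (formulas L V {} :: ('f, 'r, 'u) fm set)"
proof -
  let ?m = "map_fm (to_nat_on (funs L)) (to_nat_on (rels L)) (\<lambda>_ :: 'u. 0 :: nat)"
  have "inj_on ?m (formulas L V {})"
  proof (rule inj_onI)
    fix p q :: "('f, 'r, 'u) fm"
    assume p: "p \<in> formulas L V {}" and q: "q \<in> formulas L V {}" and eq: "?m p = ?m q"
    have "set1_fm p \<subseteq> funs L" "set2_fm p \<subseteq> rels L" "set3_fm p = {}"
      "set1_fm q \<subseteq> funs L" "set2_fm q \<subseteq> rels L" "set3_fm q = {}"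
      using p q symbols_fm[of L "{}" p] symbols_fm[of L "{}" q] params_fm[of L "{}" p] params_fm[of L "{}" q]
      by (auto simp: formulas_def)
    moreover have "inj_on (to_nat_on (funs L)) (funs L)" "inj_on (to_nat_on (rels L)) (rels L)"
      using assms by (auto simp: countable_language_def intro: inj_on_to_nat_on)
    ultimately show "p = q"
      by (intro fm.inj_map_strong[OF _ _ _ eq]) (auto dest: inj_onD)
  qed
  then show ?thesis
    by (rule countableI')
qed

section \<open>Averages approximating a finitely satisfiable measure\<close>

lemma keisler_split:
  assumes \<mu>: "keisler_measure L U x \<mu>" and p: "p \<in> formulas L x (univ U)" and q: "q \<in> formulas L x (univ U)"
  shows "\<mu> p = \<mu> (Conj p q) + \<mu> (Conj p (Neg q))"
proof -
  let ?d = "Disj (Conj p q) (Conj p (Neg q))"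
  have fm: "Conj p q \<in> formulas L x (univ U)" "Conj p (Neg q) \<in> formulas L x (univ U)" "?d \<in> formulas L x (univ U)"
    using p q by (auto simp: formulas_def)
  have "equivalent U x p ?d" "equivalent U x (Conj (Conj p q) (Conj p (Neg q))) Bot"
    by (auto simp: equivalent_def)
  then have "\<mu> p = \<mu> ?d" "\<mu> ?d = \<mu> (Conj p q) + \<mu> (Conj p (Neg q))"
    using \<mu> p fm unfolding keisler_measure_def by blast+
  then show ?thesis by simp
qed

lemma keisler_cong:
  assumes "keisler_measure L U x \<mu>" "p \<in> formulas L x (univ U)" "q \<in> formulas L x (univ U)"
    "\<And>a. sat U p a = sat U q a"
  shows "\<mu> p = \<mu> q"
  using assms unfolding keisler_measure_def equivalent_def by blast

definition weighted :: "('x \<times> real) list \<Rightarrow> ('x \<Rightarrow> real) \<Rightarrow> real" where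
  "weighted ws h = (\<Sum>(a, r)\<leftarrow>ws. r * h a)"

lemma weighted_append: "weighted (us @ vs) h = weighted us h + weighted vs h"
  by (simp add: weighted_def)

lemma weighted_cong: "(\<And>a r. (a, r) \<in> set ws \<Longrightarrow> h a = h' a) \<Longrightarrow> weighted ws h = weighted ws h'"
  unfolding weighted_def by (intro arg_cong[of _ _ sum_list] map_cong) auto

text \<open>The induction splits \<open>\<theta>\<close> along one formula after another and ends with a point of \<open>M\<close> in every atom of
  positive measure, weighted by the measure of the atom.\<close>

lemma keisler_weights:
  assumes \<mu>: "keisler_measure L U x \<mu>" and fs: "finitely_satisfiable L U x M \<mu>"
    and "\<theta> \<in> formulas L x (univ U)" "set ps \<subseteq> formulas L x (univ U)"
  shows "\<exists>ws. (\<forall>(a, r)\<in>set ws. a \<in> tuples M x \<and> sat U \<theta> a \<and> 0 \<le> r) \<and> weighted ws (\<lambda>_. 1) = \<mu> \<theta> \<and>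
    (\<forall>p\<in>set ps. weighted ws (\<lambda>a. of_bool (sat U p a)) = \<mu> (Conj \<theta> p))"
  using assms(3,4)
proof (induction ps arbitrary: \<theta>)
  case Nil
  then have "0 \<le> \<mu> \<theta>" using \<mu> by (simp add: keisler_measure_def)
  show ?case
  proof (cases "\<mu> \<theta> = 0")
    case True
    then show ?thesis by (intro exI[of _ "[]"]) (simp add: weighted_def)
  next
    case False
    then have "0 < \<mu> \<theta>" using \<open>0 \<le> \<mu> \<theta>\<close> by simp
    then obtain a where "a \<in> tuples M x" "sat U \<theta> a"
      using fs Nil.prems unfolding finitely_satisfiable_def by blast
    then show ?thesis using \<open>0 \<le> \<mu> \<theta>\<close> by (intro exI[of _ "[(a, \<mu> \<theta>)]"]) (simp add: weighted_def)
  qed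
next
  case (Cons q ps)
  let ?t = "Conj \<theta> q" and ?f = "Conj \<theta> (Neg q)"
  have fm: "?t \<in> formulas L x (univ U)" "?f \<in> formulas L x (univ U)"
    using Cons.prems by (auto simp: formulas_def)
  obtain us where us: "\<forall>(a, r)\<in>set us. a \<in> tuples M x \<and> sat U ?t a \<and> 0 \<le> r"
    "weighted us (\<lambda>_. 1) = \<mu> ?t" "\<forall>p\<in>set ps. weighted us (\<lambda>a. of_bool (sat U p a)) = \<mu> (Conj ?t p)"
    using Cons.IH[OF fm(1)] Cons.prems(2) by auto
  obtain vs where vs: "\<forall>(a, r)\<in>set vs. a \<in> tuples M x \<and> sat U ?f a \<and> 0 \<le> r"
    "weighted vs (\<lambda>_. 1) = \<mu> ?f" "\<forall>p\<in>set ps. weighted vs (\<lambda>a. of_bool (sat U p a)) = \<mu> (Conj ?f p)"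
    using Cons.IH[OF fm(2)] Cons.prems(2) by auto
  have "weighted us (\<lambda>a. of_bool (sat U q a)) = weighted us (\<lambda>_. 1)"
    using us(1) by (intro weighted_cong) auto
  moreover have "weighted vs (\<lambda>a. of_bool (sat U q a)) = 0"
    using vs(1) weighted_cong[of vs "\<lambda>a. of_bool (sat U q a)" "\<lambda>_. 0"] by (fastforce simp: weighted_def split_def)
  ultimately have q: "weighted (us @ vs) (\<lambda>a. of_bool (sat U q a)) = \<mu> ?t"
    using us(2) by (simp add: weighted_append)
  have p: "weighted (us @ vs) (\<lambda>a. of_bool (sat U p a)) = \<mu> (Conj \<theta> p)" if "p \<in> set ps" for p
  proof -
    have fms: "Conj \<theta> p \<in> formulas L x (univ U)" "q \<in> formulas L x (univ U)" "Conj ?t p \<in> formulas L x (univ U)"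
      "Conj ?f p \<in> formulas L x (univ U)" "Conj (Conj \<theta> p) q \<in> formulas L x (univ U)"
      "Conj (Conj \<theta> p) (Neg q) \<in> formulas L x (univ U)"
      using Cons.prems that by (auto simp: formulas_def)
    have "\<mu> (Conj \<theta> p) = \<mu> (Conj (Conj \<theta> p) q) + \<mu> (Conj (Conj \<theta> p) (Neg q))"
      using keisler_split[OF \<mu> fms(1,2)] .
    also have "\<mu> (Conj (Conj \<theta> p) q) = \<mu> (Conj ?t p)"
      by (rule keisler_cong[OF \<mu>]) (use fms in auto)
    also have "\<mu> (Conj (Conj \<theta> p) (Neg q)) = \<mu> (Conj ?f p)"
      by (rule keisler_cong[OF \<mu>]) (use fms in auto)
    finally show ?thesis using us(3) vs(3) that by (simp add: weighted_append)
  qed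
  have "weighted (us @ vs) (\<lambda>_. 1) = \<mu> \<theta>"
    using us(2) vs(2) keisler_split[OF \<mu>, of \<theta> q] Cons.prems by (simp add: weighted_append)
  then show ?case
    using us(1) vs(1) p q by (intro exI[of _ "us @ vs"]) auto
qed

text \<open>The added 1 keeps every point in the list, so that the list is not empty; it does not affect the
  limit.\<close>

definition rounded :: "('x \<times> real) list \<Rightarrow> nat \<Rightarrow> 'x list" where
  "rounded ws n = concat (map (\<lambda>(a, r). replicate (nat \<lfloor>real n * r\<rfloor> + 1) a) ws)"

lemma floor_ratio_tendsto:
  assumes "0 \<le> r"
  shows "(\<lambda>n. real (nat \<lfloor>real n * r\<rfloor> + 1) / real n) \<longlonglongrightarrow> r"
proof -
  have "\<forall>\<^sub>F n in sequentially. norm (real (nat \<lfloor>real n * r\<rfloor> + 1) / real n - r) \<le> 1 / real n"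
    using eventually_gt_at_top[of 0]
  proof eventually_elim
    case (elim n)
    define k where "k = real (nat \<lfloor>real n * r\<rfloor> + 1)"
    have "k = of_int \<lfloor>real n * r\<rfloor> + 1"
      using assms by (simp add: k_def)
    then have "\<bar>k - real n * r\<bar> \<le> 1" by linarith
    moreover have "k / real n - r = (k - real n * r) / real n"
      using elim by (simp add: field_simps)
    ultimately show ?case
      unfolding k_def[symmetric] by (simp add: abs_divide divide_right_mono)
  qed
  then have "(\<lambda>n. real (nat \<lfloor>real n * r\<rfloor> + 1) / real n - r) \<longlonglongrightarrow> 0"
    by (rule Lim_null_comparison) (rule lim_1_over_n)
  then show ?thesis by (simp only: LIM_zero_iff)
qed

lemma rounded_sum_tendsto:
  assumes "\<And>a r. (a, r) \<in> set ws \<Longrightarrow> 0 \<le> r"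
  shows "(\<lambda>n. (\<Sum>a\<leftarrow>rounded ws n. h a) / real n) \<longlonglongrightarrow> weighted ws h"
  using assms
proof (induction ws)
  case Nil
  then show ?case by (simp add: rounded_def weighted_def)
next
  case (Cons w ws)
  obtain a r where w: "w = (a, r)" by (cases w)
  have r: "0 \<le> r" using Cons.prems[of a r] by (simp add: w)
  have "(\<lambda>n. real (nat \<lfloor>real n * r\<rfloor> + 1) / real n * h a + (\<Sum>a\<leftarrow>rounded ws n. h a) / real n)
      \<longlonglongrightarrow> r * h a + weighted ws h"
    using Cons.prems by (intro tendsto_add tendsto_mult floor_ratio_tendsto r tendsto_const Cons.IH) auto
  moreover have "(\<Sum>a\<leftarrow>rounded (w # ws) n. h a) / real n =
      real (nat \<lfloor>real n * r\<rfloor> + 1) / real n * h a + (\<Sum>a\<leftarrow>rounded ws n. h a) / real n" for n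
    by (simp add: rounded_def w sum_list_replicate add_divide_distrib distrib_right)
  ultimately show ?case by (simp add: w weighted_def)
qed

lemma rounded_avg_tendsto:
  assumes "\<And>a r. (a, r) \<in> set ws \<Longrightarrow> 0 \<le> r" "weighted ws (\<lambda>_. 1) = 1"
  shows "(\<lambda>n. avg (rounded ws n) h) \<longlonglongrightarrow> weighted ws h"
proof -
  have len: "(\<Sum>a\<leftarrow>as. 1) = real (length as)" for as :: "'a list"
    by (induction as) auto
  have "(\<lambda>n. ((\<Sum>a\<leftarrow>rounded ws n. h a) / real n) / ((\<Sum>a\<leftarrow>rounded ws n. 1) / real n)) \<longlonglongrightarrow> weighted ws h / 1"
  proof (rule tendsto_divide)
    show "(\<lambda>n. (\<Sum>a\<leftarrow>rounded ws n. h a) / real n) \<longlonglongrightarrow> weighted ws h"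
      by (rule rounded_sum_tendsto) (rule assms(1))
    show "(\<lambda>n. (\<Sum>a\<leftarrow>rounded ws n. 1) / real n) \<longlonglongrightarrow> 1"
      using rounded_sum_tendsto[of ws "\<lambda>_. 1"] assms by metis
  qed simp
  then have "(\<lambda>n. ((\<Sum>a\<leftarrow>rounded ws n. h a) / real n) / (real (length (rounded ws n)) / real n)) \<longlonglongrightarrow> weighted ws h"
    unfolding len by simp
  then show ?thesis
  proof (rule Lim_transform_eventually)
    show "\<forall>\<^sub>F n in sequentially. ((\<Sum>a\<leftarrow>rounded ws n. h a) / real n) / (real (length (rounded ws n)) / real n)
        = avg (rounded ws n) h"
      using eventually_gt_at_top[of 0] by eventually_elim (simp add: avg_def)
  qed
qed

lemma keisler_approximation:
  assumes \<mu>: "keisler_measure L U x \<mu>" and fs: "finitely_satisfiable L U x M \<mu>"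
    and \<Phi>: "finite \<Phi>" "\<Phi> \<subseteq> formulas L x (univ U)" and "0 < \<epsilon>"
  shows "\<exists>as. as \<noteq> [] \<and> set as \<subseteq> tuples M x \<and> (\<forall>p\<in>\<Phi>. \<bar>avg as (\<lambda>a. of_bool (sat U p a)) - \<mu> p\<bar> < \<epsilon>)"
proof -
  obtain ps where ps: "set ps = \<Phi>" using finite_list[OF \<Phi>(1)] by blast
  have Top: "Top \<in> formulas L x (univ U)" by (simp add: formulas_def)
  obtain ws where ws: "\<forall>(a, r)\<in>set ws. a \<in> tuples M x \<and> sat U Top a \<and> 0 \<le> r" "weighted ws (\<lambda>_. 1) = \<mu> Top"
    "\<forall>p\<in>set ps. weighted ws (\<lambda>a. of_bool (sat U p a)) = \<mu> (Conj Top p)"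
    using keisler_weights[OF \<mu> fs Top, of ps] ps \<Phi>(2) by auto
  have one: "weighted ws (\<lambda>_. 1) = 1" using ws(2) \<mu> by (simp add: keisler_measure_def)
  have val: "weighted ws (\<lambda>a. of_bool (sat U p a)) = \<mu> p" if "p \<in> \<Phi>" for p
  proof -
    have "\<mu> (Conj Top p) = \<mu> p"
      by (rule keisler_cong[OF \<mu>]) (use that \<Phi>(2) in \<open>auto simp: formulas_def\<close>)
    then show ?thesis using ws(3) that ps by simp
  qed
  have nonneg: "0 \<le> r" if "(a, r) \<in> set ws" for a r using ws(1) that by auto
  have "\<forall>\<^sub>F n in sequentially. \<forall>p\<in>\<Phi>. \<bar>avg (rounded ws n) (\<lambda>a. of_bool (sat U p a)) - \<mu> p\<bar> < \<epsilon>"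
    unfolding eventually_ball_finite_distrib[OF \<Phi>(1)]
  proof
    fix p assume "p \<in> \<Phi>"
    have "(\<lambda>n. avg (rounded ws n) (\<lambda>a. of_bool (sat U p a))) \<longlonglongrightarrow> \<mu> p"
      unfolding val[OF \<open>p \<in> \<Phi>\<close>, symmetric] by (rule rounded_avg_tendsto[OF _ one]) (rule nonneg)
    then show "\<forall>\<^sub>F n in sequentially. \<bar>avg (rounded ws n) (\<lambda>a. of_bool (sat U p a)) - \<mu> p\<bar> < \<epsilon>"
      using \<open>0 < \<epsilon>\<close> by (simp add: tendsto_iff dist_real_def)
  qed
  then obtain n where n: "\<forall>p\<in>\<Phi>. \<bar>avg (rounded ws n) (\<lambda>a. of_bool (sat U p a)) - \<mu> p\<bar> < \<epsilon>"
    using eventually_happens'[OF sequentially_bot] by blast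
  have "ws \<noteq> []" using one by (auto simp: weighted_def)
  then have "rounded ws n \<noteq> []" by (cases ws) (auto simp: rounded_def)
  moreover have "set (rounded ws n) \<subseteq> tuples M x" using ws(1) by (auto simp: rounded_def)
  ultimately show ?thesis using n by blast
qed

lemma Av_eq_avg: "Av U as p = avg as (\<lambda>a. of_bool (sat U p a))"
proof -
  have "card {i. i < length as \<and> sat U p (as ! i)} = length (filter (sat U p) as)"
    by (simp add: length_filter_conv_card)
  also have "real \<dots> = (\<Sum>a\<leftarrow>as. of_bool (sat U p a))"
    by (induction as) auto
  finally show ?thesis by (simp add: Av_def avg_def)
qed

lemma avg_map: "avg (map e as) h = avg as (\<lambda>n. h (e n))"
  by (simp add: avg_def o_def)

section \<open>Approximation by a sequence\<close>

text \<open>The traces are taken on natural numbers, through an enumeration \<open>e\<close> of the points of \<open>M\<close>.\<close>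

definition instance_traces :: "('f, 'r, 'u) struct \<Rightarrow> nat set \<Rightarrow> (nat \<Rightarrow> nat \<Rightarrow> 'u) \<Rightarrow> ('f, 'r, 'u) fm \<Rightarrow> nat set set" where
  "instance_traces U x e p = (\<lambda>b. {n. sat U p (override_on b (e n) x)}) ` tuples U (fv p - x)"

text \<open>A shattered set of indices is mapped injectively to a shattered set of tuples, so unbounded shattered
  sets of indices would give an infinite shattered set of tuples.\<close>

lemma NIP_bounds_shattered:
  fixes U :: "('f, 'r, 'u) struct" and \<kappa> :: "'k rel"
  assumes sat: "saturated L \<kappa> U" and \<kappa>: "natLeq <o \<kappa>" and "NIP L U" and x: "finite x"
    and p: "p \<in> formulas L UNIV {}" and e: "range e \<subseteq> tuples U x"
  shows "\<exists>d. \<forall>J. finite J \<longrightarrow> shatters (instance_traces U x e p) J \<longrightarrow> card J \<le> d"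
proof (rule ccontr)
  let ?y = "fv p - x"
  assume no_bound: "\<not> ?thesis"
  have fm: "finite ?y" "x \<inter> ?y = {}" "p \<in> formulas L (x \<union> ?y) {}"
    using p finite_fv by (auto simp: formulas_def)
  have "\<exists>J'. finite J' \<and> d < card J' \<and> J' \<subseteq> tuples U x \<and> shattered U x ?y p J'" for d
  proof -
    obtain J where J: "finite J" "shatters (instance_traces U x e p) J" "d < card J"
      using no_bound by (metis not_le)
    have trace: "\<exists>b\<in>tuples U ?y. \<forall>n\<in>J. sat U p (override_on b (e n) x) \<longleftrightarrow> n \<in> I" if "I \<subseteq> J" for I
    proof -
      obtain S where "S \<in> instance_traces U x e p" "S \<inter> J = I"
        using J(2) \<open>I \<subseteq> J\<close> unfolding shatters_def by blast
      then show ?thesis unfolding instance_traces_def by blast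
    qed
    have "inj_on e J"
    proof (rule inj_onI, rule ccontr)
      fix i j assume ij: "i \<in> J" "j \<in> J" "e i = e j" "i \<noteq> j"
      then obtain b where "\<forall>n\<in>J. sat U p (override_on b (e n) x) \<longleftrightarrow> n \<in> {i}"
        using trace[of "{i}"] by blast
      from bspec[OF this ij(1)] bspec[OF this ij(2)] show False using ij(3,4) by simp
    qed
    moreover have "shattered U x ?y p (e ` J)"
      unfolding shattered_def
    proof (intro allI impI)
      fix I assume "I \<subseteq> e ` J"
      obtain b where "b \<in> tuples U ?y" "\<forall>n\<in>J. sat U p (override_on b (e n) x) \<longleftrightarrow> n \<in> {n \<in> J. e n \<in> I}"
        using trace[of "{n \<in> J. e n \<in> I}"] by blast
      then show "\<exists>b\<in>tuples U ?y. \<forall>a\<in>e ` J. sat U p (override_on b a x) = (a \<in> I)"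
        by (intro bexI[of _ b]) auto
    qed
    ultimately show ?thesis
      using J e by (intro exI[of _ "e ` J"]) (auto simp: card_image)
  qed
  then have "\<not> NIP_formula U x ?y p"
    using infinite_shattered[OF sat \<kappa> x fm] unfolding NIP_formula_def by blast
  then show False
    using \<open>NIP L U\<close> x fm unfolding NIP_def by blast
qed

theorem mainTheorem2:
  fixes L :: "('f, 'r) language"
    and T :: "('f, 'r, 'u) fm set"
    and \<kappa> :: "'k rel"
    and U M :: "('f, 'r, 'u) struct"
    and x :: "nat set"
    and \<mu> :: "('f, 'r, 'u) fm \<Rightarrow> real"
  assumes "countable_language L"
    and "complete_theory L T"
    and "monster_model L T \<kappa> U"
    and "NIP L U"
    and "finite x"
    and "elementary_substructure L M U"
    and "countable (univ M)" and "infinite (univ M)"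
    and "keisler_measure L U x \<mu>"
    and "finitely_satisfiable L U x M \<mu>"
  shows "\<exists>a :: nat \<Rightarrow> (nat \<Rightarrow> 'u) list.
           (\<forall>i. a i \<noteq> [] \<and> set (a i) \<subseteq> tuples M x) \<and>
           (\<forall>\<phi>\<in>formulas L x (univ U). (\<lambda>i. Av U (a i) \<phi>) \<longlonglongrightarrow> \<mu> \<phi>)"
proof -
  let ?X = "tuples M x" and ?F = "formulas L x (univ U)"
  have "univ M \<noteq> {}" using \<open>infinite (univ M)\<close> by auto
  then have "?X \<noteq> {}" by (simp add: PiE_eq_empty_iff)
  moreover have "countable ?X"
    using \<open>finite x\<close> \<open>countable (univ M)\<close> by (intro countable_PiE) auto
  ultimately have "range (from_nat_into ?X) = ?X"
    by (rule range_from_nat_into)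
  then obtain e :: "nat \<Rightarrow> nat \<Rightarrow> 'u" where e: "range e = ?X"
    by (rule that)
  have "univ M \<subseteq> univ U"
    using assms(6) by (simp add: elementary_substructure_def)
  then have eU: "range e \<subseteq> tuples U x"
    unfolding e by (intro PiE_mono)
  have sat: "saturated L \<kappa> U" "natLeq <o \<kappa>"
    using assms(3) by (simp_all add: monster_model_def)
  \<comment> \<open>The natural number in the index is the precision: along larger finite
    subsets of I, more formulas are approximated and each of them better.\<close>
  define I where "I = ?F \<times> (UNIV :: nat set)"
  have "\<exists>ns. ns \<noteq> [] \<and> (\<forall>(p, k)\<in>\<Phi>. \<bar>Av U (map e ns) p - \<mu> p\<bar> < 1 / real (Suc k))"
    if \<Phi>: "finite \<Phi>" "\<Phi> \<subseteq> I" for \<Phi>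
  proof -
    define K where "K = Suc (Max (insert 0 (snd ` \<Phi>)))"
    have K: "1 / real K \<le> 1 / real (Suc k)" if "(p, k) \<in> \<Phi>" for p k
    proof -
      have "k \<in> snd ` \<Phi>" using that by force
      then show ?thesis using \<Phi>(1) by (simp add: K_def frac_le)
    qed
    have "finite (fst ` \<Phi>)" "fst ` \<Phi> \<subseteq> ?F" "0 < 1 / real K"
      using \<Phi> by (auto simp: I_def K_def)
    from keisler_approximation[OF assms(9,10) this]
    obtain as where as: "as \<noteq> []" "set as \<subseteq> ?X"
      "\<forall>p\<in>fst ` \<Phi>. \<bar>avg as (\<lambda>a. of_bool (sat U p a)) - \<mu> p\<bar> < 1 / real K"
      by (elim exE conjE)
    obtain ns where ns: "as = map e ns"
      using as(2) ex_map_conv[of as e] unfolding e[symmetric] by blast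
    have "\<bar>Av U (map e ns) p - \<mu> p\<bar> < 1 / real (Suc k)" if "(p, k) \<in> \<Phi>" for p k
    proof -
      have "\<bar>Av U (map e ns) p - \<mu> p\<bar> < 1 / real K"
        using as(3) that unfolding ns Av_eq_avg by force
      then show ?thesis using K[OF that] by simp
    qed
    then show ?thesis using as(1) ns by (intro exI[of _ ns]) auto
  qed
  note approx = this
  define good where "good \<Phi> ns \<longleftrightarrow> ns \<noteq> [] \<and>
      (finite \<Phi> \<longrightarrow> \<Phi> \<subseteq> I \<longrightarrow> (\<forall>(p, k)\<in>\<Phi>. \<bar>Av U (map e ns) p - \<mu> p\<bar> < 1 / real (Suc k)))" for \<Phi> ns
  have "\<exists>ns. good \<Phi> ns" for \<Phi>
  proof (cases "finite \<Phi> \<and> \<Phi> \<subseteq> I")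
    case True
    then show ?thesis using approx[of \<Phi>] by (simp add: good_def)
  next
    case False
    then show ?thesis by (intro exI[of _ "[0]"]) (auto simp: good_def)
  qed
  then have "\<exists>A. \<forall>\<Phi>. good \<Phi> (A \<Phi>)"
    by (intro choice allI)
  then obtain A where "\<And>\<Phi>. good \<Phi> (A \<Phi>)" by blast
  then have A: "\<And>\<Phi>. A \<Phi> \<noteq> []"
    "\<And>\<Phi> p k. finite \<Phi> \<Longrightarrow> \<Phi> \<subseteq> I \<Longrightarrow> (p, k) \<in> \<Phi> \<Longrightarrow> \<bar>Av U (map e (A \<Phi>)) p - \<mu> p\<bar> < 1 / real (Suc k)"
    unfolding good_def by blast+
  have lim: "((\<lambda>\<Phi>. Av U (map e (A \<Phi>)) p) \<longlongrightarrow> \<mu> p) (finite_subsets_at_top I)" if p: "p \<in> ?F" for p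
    unfolding tendsto_iff
  proof (intro allI impI)
    fix \<epsilon> :: real assume "0 < \<epsilon>"
    then obtain k where k: "1 / real (Suc k) < \<epsilon>"
      using nat_approx_posE by blast
    show "\<forall>\<^sub>F \<Phi> in finite_subsets_at_top I. dist (Av U (map e (A \<Phi>)) p) (\<mu> p) < \<epsilon>"
      unfolding eventually_finite_subsets_at_top dist_real_def
    proof (intro exI[of _ "{(p, k)}"] conjI allI impI)
      show "{(p, k)} \<subseteq> I" using p by (simp add: I_def)
      fix \<Phi> assume "finite \<Phi> \<and> {(p, k)} \<subseteq> \<Phi> \<and> \<Phi> \<subseteq> I"
      then show "\<bar>Av U (map e (A \<Phi>)) p - \<mu> p\<bar> < \<epsilon>" using A(2)[of \<Phi> p k] k by auto
    qed simp
  qed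
  define \<C> where "\<C> = instance_traces U x e ` formulas L UNIV {}"
  have cnt: "countable \<C>"
    unfolding \<C>_def using countable_formulas[OF assms(1)] by (rule countable_image)
  have vc: "\<exists>d. \<forall>J. finite J \<longrightarrow> shatters C J \<longrightarrow> card J \<le> d" if "C \<in> \<C>" for C
    using that NIP_bounds_shattered[OF sat assms(4,5) _ eU] unfolding \<C>_def by blast
  obtain a where a: "\<And>i. a i \<noteq> []"
    "\<And>C S l. C \<in> \<C> \<Longrightarrow> S \<in> C \<Longrightarrow> ((\<lambda>\<Phi>. avg (A \<Phi>) (indicator S)) \<longlongrightarrow> l) (finite_subsets_at_top I) \<Longrightarrow>
       (\<lambda>i. avg (a i) (indicator S)) \<longlonglongrightarrow> l"
    by (rule sequential_limit_of_averages[OF finite_subsets_at_top_neq_bot[of I] A(1) cnt])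
      (erule vc, rule that)
  have "(\<lambda>i. Av U (map e (a i)) p) \<longlonglongrightarrow> \<mu> p" if p: "p \<in> ?F" for p
  proof -
    obtain q b where q: "q \<in> formulas L UNIV {}" "b \<in> tuples U (fv q - x)"
      "\<And>a. sat U p a \<longleftrightarrow> sat U q (override_on b a x)"
      using formula_as_instance[OF assms(5) p] by blast
    define S where "S = {n. sat U p (e n)}"
    have S: "S \<in> instance_traces U x e q"
      unfolding S_def q(3) instance_traces_def using q(2) by blast
    have Av: "Av U (map e ns) p = avg ns (indicator S)" for ns
      unfolding Av_eq_avg avg_map S_def by (simp add: indicator_def[abs_def] of_bool_def)
    show ?thesis
      using a(2)[of "instance_traces U x e q" S "\<mu> p"] S q(1) lim[OF p] unfolding Av \<C>_def by blast
  qed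
  moreover have "set (map e (a i)) \<subseteq> ?X" for i
    using e by auto
  ultimately show ?thesis
    using a(1) by (intro exI[of _ "\<lambda>i. map e (a i)"]) simp
qed

end
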